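(* Let $\mathfrak{M} = M(X,\mathfrak{a})^\Gamma$ be the equivariant map algebra associated to an affine scheme $X=\operatorname{Spec} A$ over $k$, a finite-dimensional unital associative $k$-algebra $\mathfrak{a}$, and a finite group $\Gamma$ acting on $X$ and on $\mathfrak{a}$ by automorphisms. Let $\rho : \mathfrak{M} \to \operatorname{End}_k V$ be an irreducible finite-dimensional representation of $\mathfrak{M}$. Then there exists a $k$-rational point $x\in X$ such that $\rho$ factors as $$\mathfrak{M} \xrightarrow{\ \operatorname{ev}_x\ } \mathfrak{a}^x \xrightarrow{\ \rho_x\ } \operatorname{End}_k V ,$$ with both maps surjective, where $\rho_x$ is an irreducible finite-dimensional representation of the finite-dimensional algebra $\mathfrak{a}^x$. Conversely, for any $k$-rational point $x\in X$ and any irreducible representation $\rho_x : \mathfrak{a}^x \to \operatorname{End}_k V$, the map $\rho_x \circ \operatorname{ev}_x$ is an irreducible representation of $\mathfrak{M}$.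
   Context: $k$ is an algebraically closed field of arbitrary characteristic; tensor products are over $k$. $A$ is a commutative associative unital $k$-algebra (not necessarily finitely generated) and $X=\operatorname{Spec} A$. $\Gamma$ is a finite group whose order is not divisible by the characteristic of $k$ (no condition in characteristic zero). $\Gamma$ acts on the scheme $X$, equivalently on the $k$-algebra $A$, by automorphisms, and on the finite-dimensional unital associative $k$-algebra $\mathfrak{a}$ by algebra automorphisms. A point $x\in X$ is $k$-rational if $A/\mathsf{m}_x\cong k$, where $\mathsf{m}_x$ is the ideal of $A$ corresponding to $x$. The map algebra is $M(X,\mathfrak{a})=\mathfrak{a}\otimes A$ with product $(\mathtt{a}_1\otimes a_1)(\mathtt{a}_2\otimes a_2)=(\mathtt{a}_1\mathtt{a}_2)\otimes(a_1a_2)$, viewed as a $k$-algebra. $\Gamma$ acts on it by $\gamma\cdot(\mathtt{a}\otimes a)=(\gamma\cdot\mathtt{a})\otimes(\gamma\cdot a)$, and the equivariant map algebra is the fixed-point subalgebra $\mathfrak{M}=M(X,\mathfrak{a})^\Gamma=(\mathfrak{a}\otimes A)^\Gamma$, equivalently the algebra of $\Gamma$-equivariant regular maps $X\to\mathfrak{a}$. It is an associative unital $k$-algebra. For a $k$-rational point $x$, let $\Gamma_x=\{\gamma\in\Gamma:\gamma\cdot x=x\}$ and $\mathfrak{a}^x=\{\mathtt{a}\in\mathfrak{a}:\gamma\cdot\mathtt{a}=\mathtt{a}\text{ for all }\gamma\in\Gamma_x\}$. The evaluation map $\operatorname{ev}_x:\mathfrak{M}\to\mathfrak{a}^x$, $\alpha\mapsto\alpha(x)$,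 is the restriction to $\mathfrak{M}$ of the map $\mathfrak{a}\otimes A\to\mathfrak{a}\otimes (A/\mathsf{m}_x)\cong\mathfrak{a}$ (its image lies in $\mathfrak{a}^x$). A representation of an associative algebra $B$ is an algebra homomorphism $B\to\operatorname{End}_k V$, for $V$ a $k$-vector space. Algebra homomorphisms between unital algebras are understood to preserve the unit, and irreducible representations are here understood to be nonzero ($V \neq 0$). *)

theory Defs
  imports
    "HOL-Computational_Algebra.Polynomial"
    "HOL-Algebra.Module"
    "HOL-Algebra.QuotRing"
    "HOL-Algebra.Group_Action"
    "HOL-Algebra.Free_Abelian_Groups"
begin

section \<open>Algebras over a field\<close>

text \<open>
  The given algebras live on whole types. Their sort is not \<open>ring_1\<close>, because that class
  demands \<open>0 \<noteq> 1\<close> and so excludes the zero algebra (for \<open>A\<close>: the empty scheme).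
\<close>

locale k_algebra = vector_space scale
  for scale :: "'k::field \<Rightarrow> 'a::{ring, monoid_mult} \<Rightarrow> 'a" +
  assumes scale_mult_left: "scale c x * y = scale c (x * y)"
    and scale_mult_right: "x * scale c y = scale c (x * y)"

text \<open>
  Subalgebras, quotients and endomorphism algebras do not fill a type; all of them are records
  of the type \<open>module\<close> of HOL-Algebra, that is, ring records with a scalar multiplication.
\<close>

definition type_alg :: "('k::field \<Rightarrow> 'a::{ring, monoid_mult} \<Rightarrow> 'a) \<Rightarrow> ('k, 'a) module" where
  "type_alg sc = \<lparr>carrier = UNIV, monoid.mult = (*), one = 1, ring.zero = 0, ring.add = (+),
     module.smult = sc\<rparr>"

definition End_alg :: "('k::field \<Rightarrow> 'v::ab_group_add \<Rightarrow> 'v) \<Rightarrow> ('k, 'v \<Rightarrow> 'v) module" where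
  "End_alg sc = \<lparr>carrier = {T. Vector_Spaces.linear sc sc T}, monoid.mult = (\<circ>), one = id,
     ring.zero = (\<lambda>v. 0), ring.add = (\<lambda>S T v. S v + T v), module.smult = (\<lambda>c T v. sc c (T v))\<rparr>"

definition quot_alg :: "('k, 'c) module \<Rightarrow> 'c set \<Rightarrow> ('k, 'c set) module" where
  "quot_alg B I = \<lparr>carrier = carrier (B Quot I), monoid.mult = monoid.mult (B Quot I), one = one (B Quot I),
     ring.zero = ring.zero (B Quot I), ring.add = ring.add (B Quot I),
     module.smult = (\<lambda>c C. \<Union>p\<in>C. I +>\<^bsub>B\<^esub> (c \<odot>\<^bsub>B\<^esub> p))\<rparr>"

definition fixed_alg :: "'g set \<Rightarrow> ('g \<Rightarrow> 'c \<Rightarrow> 'c) \<Rightarrow> ('k, 'c) module \<Rightarrow> ('k, 'c) module" where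
  "fixed_alg H act B = B\<lparr>carrier := {b \<in> carrier B. \<forall>g\<in>H. act g b = b}\<rparr>"

definition alg_hom :: "('k, 'b) module \<Rightarrow> ('k, 'c) module \<Rightarrow> ('b \<Rightarrow> 'c) set" where
  "alg_hom B C = {h \<in> ring_hom B C. \<forall>c. \<forall>x\<in>carrier B. h (c \<odot>\<^bsub>B\<^esub> x) = c \<odot>\<^bsub>C\<^esub> h x}"

definition alg_iso :: "('k, 'b) module \<Rightarrow> ('k, 'c) module \<Rightarrow> ('b \<Rightarrow> 'c) set" where
  "alg_iso B C = {h \<in> alg_hom B C. bij_betw h (carrier B) (carrier C)}"

definition acts_by_automorphisms ::
  "('g, 'm) monoid_scheme \<Rightarrow> ('k::field \<Rightarrow> 'a::{ring, monoid_mult} \<Rightarrow> 'a) \<Rightarrow> ('g \<Rightarrow> 'a \<Rightarrow> 'a) \<Rightarrow> bool" where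
  "acts_by_automorphisms G sc act \<longleftrightarrow> group_action G UNIV act \<and>
     (\<forall>g\<in>carrier G. act g \<in> alg_iso (type_alg sc) (type_alg sc))"


section \<open>Representations\<close>

definition representation ::
  "('k::field, 'c) module \<Rightarrow> ('k \<Rightarrow> 'v::ab_group_add \<Rightarrow> 'v) \<Rightarrow> ('c \<Rightarrow> 'v \<Rightarrow> 'v) \<Rightarrow> bool" where
  "representation B scV \<rho> \<longleftrightarrow> vector_space scV \<and> \<rho> \<in> alg_hom B (End_alg scV)"

definition irreducible_representation ::
  "('k::field, 'c) module \<Rightarrow> ('k \<Rightarrow> 'v::ab_group_add \<Rightarrow> 'v) \<Rightarrow> ('c \<Rightarrow> 'v \<Rightarrow> 'v) \<Rightarrow> bool" where
  "irreducible_representation B scV \<rho> \<longleftrightarrow> representation B scV \<rho> \<and>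
     (UNIV :: 'v set) \<noteq> {0} \<and>
     (\<forall>W. Modules.module.subspace scV W \<and> (\<forall>b\<in>carrier B. \<rho> b ` W \<subseteq> W) \<longrightarrow> W = {0} \<or> W = UNIV)"


section \<open>Tensor products of algebras\<close>

text \<open>
  \<open>\<aa> \<otimes> A\<close> is the free abelian group on \<open>\<aa> \<times> A\<close> modulo the subgroup generated by the usual
  relators. The free abelian group is made into the monoid ring of the multiplicative monoid
  \<open>\<aa> \<times> A\<close>; its \<open>smult\<close> is only \<open>c \<odot> (b, f) = (c b, f)\<close> extended additively, and becomes a
  \<open>k\<close>-vector space structure in the quotient.
\<close>

definition free_alg ::
  "('k::field \<Rightarrow> 'b::{ring, monoid_mult} \<Rightarrow> 'b) \<Rightarrow> ('k, ('b \<times> 'a::{ring, monoid_mult}) \<Rightarrow>\<^sub>0 int) module" where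
  "free_alg scB = \<lparr>carrier = UNIV,
     monoid.mult = (\<lambda>p q. frag_extend (\<lambda>(b, f). frag_extend (\<lambda>(b', f'). frag_of (b * b', f * f')) q) p),
     one = frag_of (1, 1), ring.zero = 0, ring.add = (+),
     module.smult = (\<lambda>c. frag_extend (\<lambda>(b, f). frag_of (scB c b, f)))\<rparr>"

definition tensor_relators ::
  "('k::field \<Rightarrow> 'b::{ring, monoid_mult} \<Rightarrow> 'b) \<Rightarrow> ('k \<Rightarrow> 'a::{ring, monoid_mult} \<Rightarrow> 'a)
    \<Rightarrow> (('b \<times> 'a) \<Rightarrow>\<^sub>0 int) set" where
  "tensor_relators scB scA =
     {frag_of (b + b', f) - frag_of (b, f) - frag_of (b', f) |b b' f. True} \<union>
     {frag_of (b, f + f') - frag_of (b, f) - frag_of (b, f') |b f f'. True} \<union>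
     {frag_of (scB c b, f) - frag_of (b, scA c f) |c b f. True}"

definition tensor_null ::
  "('k::field \<Rightarrow> 'b::{ring, monoid_mult} \<Rightarrow> 'b) \<Rightarrow> ('k \<Rightarrow> 'a::{ring, monoid_mult} \<Rightarrow> 'a)
    \<Rightarrow> (('b \<times> 'a) \<Rightarrow>\<^sub>0 int) set" where
  "tensor_null scB scA = generate (free_Abelian_group UNIV) (tensor_relators scB scA)"

definition tensor_alg ::
  "('k::field \<Rightarrow> 'b::{ring, monoid_mult} \<Rightarrow> 'b) \<Rightarrow> ('k \<Rightarrow> 'a::{ring, monoid_mult} \<Rightarrow> 'a)
    \<Rightarrow> ('k, (('b \<times> 'a) \<Rightarrow>\<^sub>0 int) set) module" where
  "tensor_alg scB scA = quot_alg (free_alg scB) (tensor_null scB scA)"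

text \<open>The diagonal action \<open>g \<cdot> (b \<otimes> f) = (g \<cdot> b) \<otimes> (g \<cdot> f)\<close>, on cosets.\<close>

definition tensor_action ::
  "('k::field \<Rightarrow> 'b::{ring, monoid_mult} \<Rightarrow> 'b) \<Rightarrow> ('k \<Rightarrow> 'a::{ring, monoid_mult} \<Rightarrow> 'a)
    \<Rightarrow> ('g \<Rightarrow> 'b \<Rightarrow> 'b) \<Rightarrow> ('g \<Rightarrow> 'a \<Rightarrow> 'a)
    \<Rightarrow> 'g \<Rightarrow> (('b \<times> 'a) \<Rightarrow>\<^sub>0 int) set \<Rightarrow> (('b \<times> 'a) \<Rightarrow>\<^sub>0 int) set" where
  "tensor_action scB scA actB actA g C =
     (\<Union>p\<in>C. tensor_null scB scA +>\<^bsub>free_alg scB\<^esub>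
        frag_extend (\<lambda>(b, f). frag_of (actB g b, actA g f)) p)"


section \<open>Equivariant map algebras\<close>

definition equivariant_map_alg ::
  "('g, 'm) monoid_scheme
    \<Rightarrow> ('k::field \<Rightarrow> 'b::{ring, monoid_mult} \<Rightarrow> 'b) \<Rightarrow> ('g \<Rightarrow> 'b \<Rightarrow> 'b)
    \<Rightarrow> ('k \<Rightarrow> 'a::{ring, monoid_mult} \<Rightarrow> 'a) \<Rightarrow> ('g \<Rightarrow> 'a \<Rightarrow> 'a)
    \<Rightarrow> ('k, (('b \<times> 'a) \<Rightarrow>\<^sub>0 int) set) module" where
  "equivariant_map_alg G scB actB scA actA =
     fixed_alg (carrier G) (tensor_action scB scA actB actA) (tensor_alg scB scA)"

text \<open>
  A point \<open>x\<close> of \<open>Spec A\<close> is represented by its prime ideal. Since \<open>m\<^sub>x\<close> consists of the functions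
  vanishing at \<open>x\<close> and \<open>(g \<cdot> f)(x) = f(g\<inverse> \<cdot> x)\<close>, the point \<open>g \<cdot> x\<close> has the ideal \<open>g ` m\<^sub>x\<close>.
  The isomorphism of \<open>A / m\<^sub>x\<close> with \<open>k\<close> is one of \<open>k\<close>-algebras, not just of rings.
\<close>

definition k_rational_point ::
  "('k::field \<Rightarrow> 'a::{comm_ring, comm_monoid_mult} \<Rightarrow> 'a) \<Rightarrow> 'a set \<Rightarrow> bool" where
  "k_rational_point scA x \<longleftrightarrow> primeideal x (type_alg scA) \<and>
     alg_iso (quot_alg (type_alg scA) x) (type_alg ((*) :: 'k \<Rightarrow> 'k \<Rightarrow> 'k)) \<noteq> {}"

definition point_stabilizer ::
  "('g, 'm) monoid_scheme \<Rightarrow> ('g \<Rightarrow> 'a \<Rightarrow> 'a) \<Rightarrow> 'a set \<Rightarrow> 'g set" where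
  "point_stabilizer G actA x = stabilizer G (\<lambda>g I. actA g ` I) x"

definition isotropy_alg ::
  "('g, 'm) monoid_scheme
    \<Rightarrow> ('k::field \<Rightarrow> 'b::{ring, monoid_mult} \<Rightarrow> 'b) \<Rightarrow> ('g \<Rightarrow> 'b \<Rightarrow> 'b)
    \<Rightarrow> ('g \<Rightarrow> 'a \<Rightarrow> 'a) \<Rightarrow> 'a set \<Rightarrow> ('k, 'b) module" where
  "isotropy_alg G scB actB actA x = fixed_alg (point_stabilizer G actA x) actB (type_alg scB)"

text \<open>
  The value \<open>f(x)\<close> in \<open>k\<close>: the image of \<open>f\<close> under \<open>A \<rightarrow> A / m\<^sub>x \<cong> k\<close>. On the carrier of
  \<open>A / m\<^sub>x\<close> the isomorphism is unique, so the choice is harmless.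
\<close>

definition value_at ::
  "('k::field \<Rightarrow> 'a::{comm_ring, comm_monoid_mult} \<Rightarrow> 'a) \<Rightarrow> 'a set \<Rightarrow> 'a \<Rightarrow> 'k" where
  "value_at scA x f =
     (SOME h. h \<in> alg_iso (quot_alg (type_alg scA) x) (type_alg (*))) (x +>\<^bsub>type_alg scA\<^esub> f)"

text \<open>
  \<open>\<aa> \<otimes> A \<rightarrow> \<aa> \<otimes> (A / m\<^sub>x) \<cong> \<aa> \<otimes> k \<cong> \<aa>\<close> sends \<open>b \<otimes> f\<close> to \<open>f(x) b\<close>. The additive extension of this
  to the free abelian group is constant on cosets; the common value is \<open>ev\<^sub>x\<close>.
\<close>

definition evaluation ::
  "('k::field \<Rightarrow> 'b::{ring, monoid_mult} \<Rightarrow> 'b) \<Rightarrow> ('k \<Rightarrow> 'a::{comm_ring, comm_monoid_mult} \<Rightarrow> 'a)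
    \<Rightarrow> 'a set \<Rightarrow> (('b \<times> 'a) \<Rightarrow>\<^sub>0 int) set \<Rightarrow> 'b" where
  "evaluation scB scA x C =
     the_elem ((\<lambda>p. \<Sum>(b, f)\<in>Poly_Mapping.keys p.
        scB (of_int (Poly_Mapping.lookup p (b, f)) * value_at scA x f) b) ` C)"

end

theory Submission
  imports Defs
begin

text \<open>
  Write \<open>\<Gamma>\<close> for the group and \<open>\<aa>\<close> for the finite-dimensional algebra.

  The converse is formal once \<open>ev\<^sub>x\<close> is known to be onto \<open>\<aa>\<^sup>x\<close>, because irreducibility depends only on
  the set of operators. It is onto (\<open>evaluation_surjective\<close>) because \<open>|\<Gamma>\<^sub>x|\<close> is invertible in \<open>k\<close>: if
  \<open>f\<close> has value \<open>1\<close> at \<open>x\<close> and \<open>0\<close> on the rest of the orbit of \<open>x\<close>, the invariant element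
  \<open>\<Sum>\<gamma>. \<gamma> \<cdot> (b \<otimes> f)\<close> has value \<open>|\<Gamma>\<^sub>x| b\<close> at \<open>x\<close> for \<open>b \<in> \<aa>\<^sup>x\<close>.

  Now let \<open>\<rho>\<close> be irreducible and of finite dimension. As \<open>|\<Gamma>|\<close> is invertible in \<open>k\<close>, the operators
  \<open>t b f = \<rho> (\<Sum>\<gamma>. \<gamma> \<cdot> (b \<otimes> f))\<close> span the image of \<open>\<rho>\<close>. The functions \<open>f\<close> with \<open>t b (f h) = 0\<close> for all
  \<open>b\<close> and \<open>h\<close> form a \<open>\<Gamma>\<close>-stable ideal \<open>Q\<close> of \<open>A\<close>. Three facts lead from \<open>Q\<close> to the point \<open>x\<close>:

  \<^item> Irreducibility makes \<open>Q\<close> a prime among the \<open>\<Gamma>\<close>-stable ideals (\<open>trace_kernel_group_prime\<close>). So an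
    ideal \<open>m\<close> that is maximal among the ideals that contain \<open>Q\<close> and satisfy \<open>\<Inter>\<gamma>. \<gamma> m \<subseteq> Q\<close> is prime.

  \<^item> By Schur's lemma every invariant function is a scalar modulo \<open>Q\<close>
    (\<open>invariant_scalar_mod_trace_kernel\<close>).

  \<^item> Every \<open>f\<close> is a root of \<open>\<Prod>\<gamma>. (X - \<gamma> f)\<close>, whose coefficients are invariant. Modulo \<open>Q\<close>, and so modulo
    \<open>m\<close>, it is a root of a monic polynomial over \<open>k\<close>. As \<open>k\<close> is algebraically closed and \<open>m\<close> is prime,
    \<open>f\<close> is a scalar modulo \<open>m\<close>.

  Hence \<open>m\<close> is the ideal of a rational point \<open>x\<close>, and a function that vanishes on the orbit of \<open>x\<close> is in
  \<open>Q\<close> (\<open>character_controls_trace\<close>). If \<open>\<alpha> = \<Sum>e. e \<otimes> f\<^sub>e\<close>, with \<open>e\<close> in a basis of \<open>\<aa>\<close>, is invariant and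
  vanishes at \<open>x\<close>, then it vanishes on the orbit of \<open>x\<close>, so every \<open>f\<^sub>e\<close> is in \<open>Q\<close> and
  \<open>|\<Gamma>| \<rho>(\<alpha>) = \<Sum>e. t e f\<^sub>e = 0\<close> (\<open>rep_kernel\<close>). Thus \<open>\<rho>\<close> factors through \<open>ev\<^sub>x\<close>; that its image is
  all of \<open>End V\<close> is Burnside's theorem, proved here by Jacobson's density argument.

  The tensor product is handled on the free abelian group on \<open>\<aa> \<times> A\<close>: maps are defined there by
  additive extension, and they pass to the quotient when they respect the subgroup of relations.
\<close>

section \<open>Eigenvectors modulo a subspace\<close>

text \<open>The vector \<open>p(\<phi>) v\<close>. The vector is part of the definition because operators do not form
  a ring on a type.\<close>

definition poly_apply ::
  "('k::comm_semiring_0 \<Rightarrow> 'v::comm_monoid_add \<Rightarrow> 'v) \<Rightarrow> ('v \<Rightarrow> 'v) \<Rightarrow> 'v \<Rightarrow> 'k poly \<Rightarrow> 'v" where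
  "poly_apply sc \<phi> v p = (\<Sum>i\<le>degree p. sc (coeff p i) ((\<phi> ^^ i) v))"

lemma coeff_sum_monom: "coeff (\<Sum>i\<le>n. monom (c i) i) j = (if j \<le> n then c j else 0)"
  by (simp add: coeff_sum coeff_monom)

context vector_space
begin

lemma poly_apply_upto:
  assumes "degree p \<le> n"
  shows "poly_apply scale \<phi> v p = (\<Sum>i\<le>n. scale (coeff p i) ((\<phi> ^^ i) v))"
  unfolding poly_apply_def
  by (rule sum.mono_neutral_left) (use assms in \<open>auto simp: coeff_eq_0\<close>)

lemma poly_apply_sum_monom:
  "poly_apply scale \<phi> v (\<Sum>i\<le>n. monom (c i) i) = (\<Sum>i\<le>n. scale (c i) ((\<phi> ^^ i) v))"
proof -
  have "degree (\<Sum>i\<le>n. monom (c i) i) \<le> n"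
    by (rule degree_le) (simp add: coeff_sum_monom)
  then show ?thesis
    by (simp add: poly_apply_upto coeff_sum_monom)
qed

lemma poly_apply_linear_factor:
  assumes "Vector_Spaces.linear scale scale \<phi>"
  shows "poly_apply scale \<phi> v ([:-a, 1:] * q) =
    \<phi> (poly_apply scale \<phi> v q) - scale a (poly_apply scale \<phi> v q)"
proof -
  interpret \<phi>: Vector_Spaces.linear scale scale \<phi> by fact
  let ?p = "[:-a, 1:] * q" and ?n = "degree q"
  have c: "coeff ?p i = (case i of 0 \<Rightarrow> 0 | Suc j \<Rightarrow> coeff q j) - a * coeff q i" for i
    by (simp add: coeff_pCons split: nat.splits)
  have "degree ?p \<le> Suc ?n"
    using degree_mult_le[of "[:-a, 1:]" q] by simp
  then have "poly_apply scale \<phi> v ?p = (\<Sum>i\<le>Suc ?n. scale (coeff ?p i) ((\<phi> ^^ i) v))"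
    by (rule poly_apply_upto)
  also have "\<dots> = (\<Sum>i\<le>Suc ?n. scale (case i of 0 \<Rightarrow> 0 | Suc j \<Rightarrow> coeff q j) ((\<phi> ^^ i) v))
      - (\<Sum>i\<le>Suc ?n. scale a (scale (coeff q i) ((\<phi> ^^ i) v)))"
    unfolding c by (simp add: scale_left_diff_distrib sum_subtractf)
  also have "(\<Sum>i\<le>Suc ?n. scale (case i of 0 \<Rightarrow> 0 | Suc j \<Rightarrow> coeff q j) ((\<phi> ^^ i) v))
      = (\<Sum>i\<le>?n. scale (coeff q i) ((\<phi> ^^ Suc i) v))"
    by (subst sum.atMost_Suc_shift) simp
  also have "\<dots> = \<phi> (poly_apply scale \<phi> v q)"
    by (simp add: poly_apply_def \<phi>.sum \<phi>.scale)
  also have "(\<Sum>i\<le>Suc ?n. scale a (scale (coeff q i) ((\<phi> ^^ i) v))) = scale a (poly_apply scale \<phi> v q)"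
    by (simp only: poly_apply_upto[of q "Suc ?n" \<phi> v, OF le_SucI, OF order_refl] scale_sum_right)
  finally show ?thesis .
qed

end

text \<open>
  Apply the linear factors of \<open>p\<close> to \<open>v\<close> one after the other: the last vector before \<open>W\<close> is reached
  is an eigenvector modulo \<open>W\<close>. For \<open>W = {0}\<close> it is an eigenvector of \<open>\<phi>\<close>; for a prime ideal
  \<open>W\<close> and the multiplication \<open>\<phi>\<close> by a function, it shows that this function is a scalar modulo \<open>W\<close>.
\<close>

lemma eigenvector_modulo_subspace:
  fixes scale :: "'k::alg_closed_field \<Rightarrow> 'v::ab_group_add \<Rightarrow> 'v"
  assumes "vector_space scale" and lin: "Vector_Spaces.linear scale scale \<phi>"
    and W: "Modules.module.subspace scale W"
    and "v \<notin> W" and "p \<noteq> 0" and "poly_apply scale \<phi> v p \<in> W"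
  shows "\<exists>w a. w \<notin> W \<and> \<phi> w - scale a w \<in> W"
proof -
  interpret vector_space scale by fact
  show ?thesis
    using assms(4-)
  proof (induction "degree p" arbitrary: p)
    case 0
    then obtain c where c: "p = [:c:]" "c \<noteq> 0"
      using degree_eq_zeroE by (metis pCons_0_0)
    then have "scale c v \<in> W"
      using 0 by (simp add: poly_apply_def)
    then have "scale (inverse c) (scale c v) \<in> W"
      by (rule subspace_scale[OF W])
    then show ?case
      using c 0 by simp
  next
    case (Suc n)
    obtain a where "poly p a = 0"
      using alg_closed_imp_poly_has_root[of p] Suc.hyps(2) by auto
    then obtain q where q: "p = [:-a, 1:] * q"
      using poly_eq_0_iff_dvd by blast
    then have "q \<noteq> 0"
      using Suc.prems by auto
    then have "degree q = n"
      using Suc.hyps(2) unfolding q by (subst (asm) degree_mult_eq) auto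
    show ?case
    proof (cases "poly_apply scale \<phi> v q \<in> W")
      case True
      then show ?thesis
        using Suc.hyps(1)[of q] \<open>degree q = n\<close> \<open>q \<noteq> 0\<close> \<open>v \<notin> W\<close> by simp
    next
      case False
      then show ?thesis
        using Suc.prems(3) unfolding q poly_apply_linear_factor[OF lin] by blast
    qed
  qed
qed

text \<open>More than \<open>dim V\<close> iterates of \<open>v\<close> under \<open>\<phi>\<close> satisfy a linear relation \<open>p(\<phi>) v = 0\<close>.\<close>

lemma linear_eigenvector_exists:
  fixes scale :: "'k::alg_closed_field \<Rightarrow> 'v::ab_group_add \<Rightarrow> 'v"
  assumes fd: "finite_dimensional_vector_space scale Basis"
    and lin: "Vector_Spaces.linear scale scale \<phi>" and nz: "(v::'v) \<noteq> 0"
  shows "\<exists>w a. w \<noteq> 0 \<and> \<phi> w = scale a w"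
proof -
  interpret finite_dimensional_vector_space scale Basis by fact
  define n where "n = dim (UNIV :: 'v set)"
  let ?x = "\<lambda>i. (\<phi> ^^ i) v"
  have "\<exists>p. p \<noteq> 0 \<and> poly_apply scale \<phi> v p = 0"
  proof (cases "inj_on ?x {..n}")
    case True
    then have "card (?x ` {..n}) > dim (UNIV :: 'v set)"
      by (simp add: card_image n_def)
    then have "dependent (?x ` {..n})"
      using independent_card_le_dim[of "?x ` {..n}" UNIV] by fastforce
    then obtain u i where u: "i \<le> n" "u (?x i) \<noteq> 0" "(\<Sum>w\<in>?x ` {..n}. scale (u w) w) = 0"
      by (auto simp: dependent_finite)
    let ?p = "\<Sum>i\<le>n. monom (u (?x i)) i"
    have "coeff ?p i \<noteq> 0"
      using u by (simp add: coeff_sum_monom)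
    moreover have "poly_apply scale \<phi> v ?p = 0"
      using u(3) by (simp add: poly_apply_sum_monom sum.reindex[OF True])
    ultimately show ?thesis
      by (intro exI[of _ ?p]) auto
  next
    case False
    then obtain i j where ij: "i \<le> n" "j \<le> n" "i \<noteq> j" "?x i = ?x j"
      by (auto simp: inj_on_def)
    define c :: "nat \<Rightarrow> 'k" where "c = (\<lambda>l. if l = i then 1 else if l = j then -1 else 0)"
    \<comment> \<open>The polynomial \<open>X^i - X^j\<close>; a relation between distinct vectors would not detect this case.\<close>
    let ?p = "\<Sum>l\<le>n. monom (c l) l"
    have "coeff ?p i \<noteq> 0"
      using ij by (simp add: coeff_sum_monom c_def)
    moreover have "poly_apply scale \<phi> v ?p = (\<Sum>l\<in>{i, j}. scale (c l) (?x l))"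
      unfolding poly_apply_sum_monom
      by (rule sum.mono_neutral_right) (use ij in \<open>auto simp: c_def\<close>)
    then have "poly_apply scale \<phi> v ?p = 0"
      using ij by (simp add: c_def)
    ultimately show ?thesis
      by (intro exI[of _ ?p]) auto
  qed
  then obtain p where "p \<noteq> 0" "poly_apply scale \<phi> v p = 0" by blast
  then show ?thesis
    using eigenvector_modulo_subspace[OF vector_space_axioms lin subspace_single_0, of v p] nz
    by auto
qed


section \<open>Irreducible sets of operators\<close>

locale irreducible_operators = finite_dimensional_vector_space scale Basis
  for scale :: "'k::alg_closed_field \<Rightarrow> 'v::ab_group_add \<Rightarrow> 'v" and Basis +
  fixes S :: "('v \<Rightarrow> 'v) set"
  assumes operator_linear: "T \<in> S \<Longrightarrow> Vector_Spaces.linear scale scale T"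
    and nonzero_space: "(UNIV :: 'v set) \<noteq> {0}"
    and invariant_trivial: "subspace W \<Longrightarrow> (\<And>T. T \<in> S \<Longrightarrow> T ` W \<subseteq> W) \<Longrightarrow> W = {0} \<or> W = UNIV"
begin

lemma schur:
  assumes lin: "Vector_Spaces.linear scale scale \<phi>"
    and comm: "\<And>T v. T \<in> S \<Longrightarrow> \<phi> (T v) = T (\<phi> v)"
  shows "\<exists>a. \<forall>v. \<phi> v = scale a v"
proof -
  interpret \<phi>: Vector_Spaces.linear scale scale \<phi> by fact
  obtain u :: 'v where "u \<noteq> 0"
    using nonzero_space by auto
  then obtain w a where w: "w \<noteq> 0" "\<phi> w = scale a w"
    using linear_eigenvector_exists[OF finite_dimensional_vector_space_axioms lin] by blast
  let ?W = "{v. \<phi> v = scale a v}"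
  have "subspace ?W"
    by (rule subspaceI)
      (auto simp: \<phi>.add \<phi>.scale \<phi>.zero scale_right_distrib mult.commute)
  moreover have "T ` ?W \<subseteq> ?W" if "T \<in> S" for T
  proof -
    interpret T: Vector_Spaces.linear scale scale T by (rule operator_linear[OF that])
    show ?thesis
      by (auto simp: comm[OF that] T.scale)
  qed
  ultimately have "?W = UNIV"
    using invariant_trivial[of ?W] w by blast
  then show ?thesis by blast
qed

end

locale irreducible_operator_algebra = irreducible_operators +
  assumes add_closed: "T \<in> S \<Longrightarrow> U \<in> S \<Longrightarrow> (\<lambda>v. T v + U v) \<in> S"
    and scale_closed: "T \<in> S \<Longrightarrow> (\<lambda>v. scale a (T v)) \<in> S"
    and comp_closed: "T \<in> S \<Longrightarrow> U \<in> S \<Longrightarrow> T \<circ> U \<in> S"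
    and id_closed: "id \<in> S"
begin

lemma zero_closed: "(\<lambda>v. 0) \<in> S"
  using scale_closed[OF id_closed, of 0] by simp

lemma sum_closed: "(\<And>i. i \<in> I \<Longrightarrow> T i \<in> S) \<Longrightarrow> (\<lambda>v. \<Sum>i\<in>I. T i v) \<in> S"
  by (induction I rule: infinite_finite_induct) (auto intro: add_closed zero_closed)

text \<open>The vectors \<open>T u\<close> with \<open>T\<close> in the left ideal \<open>L\<close> form an invariant subspace.\<close>

lemma left_ideal_transitive:
  assumes add: "\<And>T U. T \<in> L \<Longrightarrow> U \<in> L \<Longrightarrow> (\<lambda>v. T v + U v) \<in> L"
    and comp: "\<And>T U. T \<in> S \<Longrightarrow> U \<in> L \<Longrightarrow> T \<circ> U \<in> L"
    and "T0 \<in> L" "T0 u \<noteq> 0"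
  shows "\<exists>T\<in>L. T u = w"
proof -
  let ?W = "(\<lambda>T. T u) ` L"
  have scale': "(\<lambda>v. scale a (T v)) \<in> L" if "T \<in> L" for T a
    using comp[OF scale_closed[OF id_closed] that] by (simp add: comp_def)
  have "subspace ?W"
  proof (rule subspaceI)
    show "0 \<in> ?W"
      using scale'[OF \<open>T0 \<in> L\<close>, of 0] by (auto intro!: rev_image_eqI)
    show "x + y \<in> ?W" if xy: "x \<in> ?W" "y \<in> ?W" for x y
    proof -
      obtain T U where TU: "T \<in> L" "U \<in> L" "x = T u" "y = U u"
        using xy by blast
      then show ?thesis
        by (intro rev_image_eqI[OF add[OF TU(1,2)]]) simp
    qed
    show "scale a x \<in> ?W" if x: "x \<in> ?W" for x a
    proof -
      obtain T where "T \<in> L" "x = T u"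
        using x by blast
      then show ?thesis
        by (intro rev_image_eqI[OF scale']) simp_all
    qed
  qed
  moreover have "T ` ?W \<subseteq> ?W" if T: "T \<in> S" for T
  proof
    fix x assume "x \<in> T ` ?W"
    then obtain P where P: "P \<in> L" "x = T (P u)"
      by auto
    show "x \<in> ?W"
      by (rule image_eqI[OF _ comp[OF T P(1)]]) (simp add: P(2))
  qed
  ultimately have "?W = UNIV"
    using invariant_trivial[of ?W] assms(3,4) by blast
  then have "w \<in> ?W" by simp
  then show ?thesis by auto
qed

text \<open>
  The inductive step of Jacobson's density theorem. Let \<open>L\<close> be the left ideal of all operators that
  kill \<open>U\<close>. If each element of \<open>L\<close> that kills \<open>u\<close> also kills \<open>v\<close>, then \<open>T u \<mapsto> T v\<close> (\<open>T \<in> L\<close>) is a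
  well-defined linear map on \<open>L u = V\<close> that commutes with \<open>S\<close>. By Schur's lemma it is a scalar \<open>a\<close>,
  so that \<open>L\<close> kills \<open>v - a u\<close>, and the induction hypothesis puts \<open>v - a u\<close> into the span of \<open>U\<close>.
\<close>

lemma density:
  assumes "finite U" "v \<notin> span U"
  shows "\<exists>T\<in>S. (\<forall>u\<in>U. T u = 0) \<and> T v \<noteq> 0"
  using assms
proof (induction U arbitrary: v rule: finite_induct)
  case empty
  then show ?case
    using id_closed by (intro bexI[of _ id]) auto
next
  case (insert u U)
  define L where "L = {T\<in>S. \<forall>x\<in>U. T x = 0}"
  show ?case
  proof (cases "u \<in> span U")
    case True
    then have "v \<notin> span U"
      using insert.prems span_redundant by blast
    then obtain T where T: "T \<in> S" "\<forall>x\<in>U. T x = 0" "T v \<noteq> 0"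
      using insert.IH by blast
    interpret T: Vector_Spaces.linear scale scale T
      by (rule operator_linear) fact
    have "T u = 0"
      using T.eq_0_on_span[of U u] T(2) True by blast
    then show ?thesis
      using T by auto
  next
    case False
    obtain T0 where T0: "T0 \<in> L" "T0 u \<noteq> 0"
      using insert.IH[OF False] by (auto simp: L_def)
    have L_lin: "Vector_Spaces.linear scale scale T" if "T \<in> L" for T
      using that operator_linear by (simp add: L_def)
    have S0: "T 0 = 0" if "T \<in> S" for T
    proof -
      interpret T: Vector_Spaces.linear scale scale T by (rule operator_linear) fact
      show ?thesis by (rule T.zero)
    qed
    have L_add: "(\<lambda>v. T v + P v) \<in> L" if "T \<in> L" "P \<in> L" for T P
      using that add_closed by (simp add: L_def)
    have L_comp: "T \<circ> P \<in> L" if "T \<in> S" "P \<in> L" for T P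
      using that comp_closed by (simp add: L_def S0)
    have L_scale: "(\<lambda>v. scale a (T v)) \<in> L" if "T \<in> L" for T a
      using that scale_closed by (simp add: L_def)
    have onto: "\<exists>T\<in>L. T u = w" for w
      by (rule left_ideal_transitive[OF L_add L_comp T0])
    show ?thesis
    proof (rule ccontr)
      assume none: "\<not> ?thesis"
      have vanish: "T v = 0" if "T \<in> L" "T u = 0" for T
        using none that unfolding L_def by auto
      define \<phi> where "\<phi> w = (SOME T. T \<in> L \<and> T u = w) v" for w
      have \<phi>: "\<phi> (T u) = T v" if "T \<in> L" for T
      proof -
        define P where "P = (SOME P. P \<in> L \<and> P u = T u)"
        have P: "P \<in> L \<and> P u = T u"
          unfolding P_def by (rule someI[of _ T]) (use that in simp)
        then have "(\<lambda>v. P v + scale (-1) (T v)) \<in> L"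
          by (intro L_add L_scale) (use that in auto)
        then have "P v + scale (-1) (T v) = 0"
          using vanish P by force
        then show ?thesis
          by (simp add: \<phi>_def P_def)
      qed
      have "Vector_Spaces.linear scale scale \<phi>"
      proof (rule Vector_Spaces.linear.intro[OF vector_space_axioms vector_space_axioms module_hom.intro];
          (rule module_axioms | unfold_locales))
        fix x y a
        obtain P Q where P: "P \<in> L" "P u = x" and Q: "Q \<in> L" "Q u = y"
          using onto by meson
        show "\<phi> (x + y) = \<phi> x + \<phi> y"
          using \<phi>[OF L_add[OF P(1) Q(1)]] \<phi>[OF P(1)] \<phi>[OF Q(1)] P Q by simp
        show "\<phi> (scale a x) = scale a (\<phi> x)"
          using \<phi>[OF L_scale[OF P(1)]] \<phi>[OF P(1)] P by simp
      qed
      moreover have "\<phi> (T w) = T (\<phi> w)" if T: "T \<in> S" for T w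
      proof -
        obtain P where P: "P \<in> L" "P u = w"
          using onto by meson
        show ?thesis
          using \<phi>[OF L_comp[OF T P(1)]] \<phi>[OF P(1)] P by simp
      qed
      ultimately obtain a where a: "\<phi> w = scale a w" for w
        using schur by blast
      have "T (v - scale a u) = 0" if "T \<in> L" for T
      proof -
        interpret T: Vector_Spaces.linear scale scale T by (rule L_lin) fact
        show ?thesis
          using \<phi>[OF that] a[of "T u"] by (simp add: T.diff T.scale)
      qed
      then have "v - scale a u \<in> span U"
        using insert.IH by (auto simp: L_def)
      then show False
        using insert.prems span_breakdown_eq by blast
    qed
  qed
qed

text \<open>
  By density some operator in \<open>S\<close> kills all basis vectors but \<open>e\<close>, and by transitivity it can be
  corrected on the left so that it sends \<open>e\<close> to \<open>L e\<close>; the sum of these operators over \<open>e\<close> is \<open>L\<close>.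
\<close>

theorem burnside:
  assumes lin: "Vector_Spaces.linear scale scale L"
  shows "L \<in> S"
proof -
  interpret L: Vector_Spaces.linear scale scale L by fact
  have "\<exists>T\<in>S. T e = L e \<and> (\<forall>d\<in>Basis - {e}. T d = 0)" if e: "e \<in> Basis" for e
  proof -
    have "e \<notin> span (Basis - {e})"
      using e independent_Basis by (auto simp: dependent_def)
    then obtain T where T: "T \<in> S" "\<forall>d\<in>Basis - {e}. T d = 0" "T e \<noteq> 0"
      using density[of "Basis - {e}"] finite_Basis by blast
    obtain P where P: "P \<in> S" "P (T e) = L e"
      using left_ideal_transitive[of S id "T e" "L e"] T(3) id_closed add_closed comp_closed
      by auto
    interpret P: Vector_Spaces.linear scale scale P by (rule operator_linear[OF P(1)])
    show ?thesis
      using P T comp_closed by (intro bexI[of _ "P \<circ> T"]) (auto simp: P.zero)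
  qed
  then obtain T where T: "\<And>e. e \<in> Basis \<Longrightarrow> T e \<in> S" "\<And>e. e \<in> Basis \<Longrightarrow> T e e = L e"
      "\<And>e d. e \<in> Basis \<Longrightarrow> d \<in> Basis \<Longrightarrow> d \<noteq> e \<Longrightarrow> T e d = 0"
    by (metis Diff_iff singletonD)
  let ?M = "\<lambda>v. \<Sum>e\<in>Basis. T e v"
  have M: "?M \<in> S"
    by (rule sum_closed) (rule T(1))
  have "?M d = L d" if "d \<in> Basis" for d
  proof -
    have "?M d = (\<Sum>e\<in>{d}. T e d)"
      by (rule sum.mono_neutral_right) (use that finite_Basis T in auto)
    then show ?thesis
      using T(2) that by simp
  qed
  then have "?M v = L v" for v
    using vector_space_pair.linear_eq_on[OF vector_space_pair.intro[OF vector_space_axioms vector_space_axioms]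
        operator_linear[OF M] lin, of v Basis] span_Basis by blast
  then show ?thesis
    using M by (metis (no_types, lifting) ext)
qed

end


section \<open>Algebras and ideals on whole types\<close>

lemma type_alg_simps [simp]:
  "carrier (type_alg sc) = UNIV" "x \<otimes>\<^bsub>type_alg sc\<^esub> y = x * y" "\<one>\<^bsub>type_alg sc\<^esub> = 1"
  "\<zero>\<^bsub>type_alg sc\<^esub> = 0" "x \<oplus>\<^bsub>type_alg sc\<^esub> y = x + y" "c \<odot>\<^bsub>type_alg sc\<^esub> x = sc c x"
  by (simp_all add: type_alg_def)

lemma alg_hom_type_alg_iff:
  "h \<in> alg_hom (type_alg sc) (type_alg sc') \<longleftrightarrow>
    (\<forall>x y. h (x + y) = h x + h y) \<and> (\<forall>x y. h (x * y) = h x * h y) \<and> h 1 = 1 \<and>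
    (\<forall>c x. h (sc c x) = sc' c (h x))"
  by (auto simp: alg_hom_def ring_hom_def)

lemma ring_type_alg: "ring (type_alg sc)"
proof (rule ringI)
  show "abelian_group (type_alg sc)"
    by (rule abelian_groupI) (auto simp: algebra_simps intro: exI[of _ "- x" for x] left_minus)
  show "Group.monoid (type_alg sc)"
    by unfold_locales (auto simp: mult.assoc)
qed (auto simp: distrib_left distrib_right)

lemma cring_type_alg:
  fixes sc :: "'k::field \<Rightarrow> 'a::{comm_ring, comm_monoid_mult} \<Rightarrow> 'a"
  shows "cring (type_alg sc)"
  by (intro cring.intro ring_type_alg comm_monoid.intro Ring.ring.is_monoid comm_monoid_axioms.intro)
    (simp add: mult.commute)

lemma a_minus_type_alg: "\<ominus>\<^bsub>type_alg sc\<^esub> x = - x"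
proof -
  interpret ring "type_alg sc" by (rule ring_type_alg)
  show ?thesis
    by (rule minus_equality) auto
qed

lemma ideal_type_alg_iff:
  fixes sc :: "'k::field \<Rightarrow> 'a::{comm_ring, comm_monoid_mult} \<Rightarrow> 'a"
  shows "ideal m (type_alg sc) \<longleftrightarrow>
    0 \<in> m \<and> (\<forall>x\<in>m. \<forall>y\<in>m. x + y \<in> m) \<and> (\<forall>x\<in>m. \<forall>a. x * a \<in> m)"
proof
  assume "ideal m (type_alg sc)"
  then interpret ideal m "type_alg sc" .
  show "0 \<in> m \<and> (\<forall>x\<in>m. \<forall>y\<in>m. x + y \<in> m) \<and> (\<forall>x\<in>m. \<forall>a. x * a \<in> m)"
    using additive_subgroup.zero_closed[OF additive_subgroup_axioms]
      additive_subgroup.a_closed[OF additive_subgroup_axioms] I_r_closed by simp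
next
  assume m: "0 \<in> m \<and> (\<forall>x\<in>m. \<forall>y\<in>m. x + y \<in> m) \<and> (\<forall>x\<in>m. \<forall>a. x * a \<in> m)"
  have "- x \<in> m" if "x \<in> m" for x
    using m that by (metis mult.right_neutral mult_minus_right)
  moreover have inv: "inv\<^bsub>add_monoid (type_alg sc)\<^esub> x = - x" for x
    using a_minus_type_alg[of sc x] by (simp only: a_inv_def)
  ultimately have "subgroup m (add_monoid (type_alg sc))"
    using m by (intro group.subgroupI abelian_group.a_group ring.is_abelian_group ring_type_alg)
      (auto simp: inv[simplified])
  then show "ideal m (type_alg sc)"
    using m by (intro idealI ring_type_alg) (auto simp: mult.commute)
qed

lemma ideal_type_algD:
  fixes sc :: "'k::field \<Rightarrow> 'a::{comm_ring, comm_monoid_mult} \<Rightarrow> 'a"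
  assumes "ideal m (type_alg sc)"
  shows "0 \<in> m" "x \<in> m \<Longrightarrow> y \<in> m \<Longrightarrow> x + y \<in> m" "x \<in> m \<Longrightarrow> x * a \<in> m" "x \<in> m \<Longrightarrow> a * x \<in> m"
    "x \<in> m \<Longrightarrow> - x \<in> m" "x \<in> m \<Longrightarrow> y \<in> m \<Longrightarrow> x - y \<in> m"
proof -
  have *: "0 \<in> m" "\<And>x y. x \<in> m \<Longrightarrow> y \<in> m \<Longrightarrow> x + y \<in> m" "\<And>x a. x \<in> m \<Longrightarrow> x * a \<in> m"
    using assms by (auto simp: ideal_type_alg_iff)
  have neg: "- x \<in> m" if "x \<in> m" for x
    using *(3)[OF that, of "- 1"] by simp
  show "0 \<in> m" "x \<in> m \<Longrightarrow> y \<in> m \<Longrightarrow> x + y \<in> m" "x \<in> m \<Longrightarrow> x * a \<in> m" "x \<in> m \<Longrightarrow> - x \<in> m"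
    using * neg by auto
  show "x \<in> m \<Longrightarrow> a * x \<in> m"
    using *(3) by (metis mult.commute)
  show "x \<in> m \<Longrightarrow> y \<in> m \<Longrightarrow> x - y \<in> m"
    using *(2)[of x "- y"] neg by simp
qed

lemma ideal_type_alg_sum:
  fixes sc :: "'k::field \<Rightarrow> 'a::{comm_ring, comm_monoid_mult} \<Rightarrow> 'a"
  assumes "ideal m (type_alg sc)" and "\<And>i. i \<in> I \<Longrightarrow> u i \<in> m"
  shows "sum u I \<in> m"
  using assms(2) by (induction I rule: infinite_finite_induct)
    (auto intro: ideal_type_algD[OF assms(1)])

lemma (in k_algebra) scale_one_mult: "scale c 1 * x = scale c x"
  by (simp add: scale_mult_left)

lemma ideal_type_alg_subspace:
  fixes sc :: "'k::field \<Rightarrow> 'a::{comm_ring, comm_monoid_mult} \<Rightarrow> 'a"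
  assumes "k_algebra sc" and m: "ideal m (type_alg sc)"
  shows "Modules.module.subspace sc m"
proof -
  interpret k_algebra sc by fact
  show ?thesis
  proof (rule subspaceI)
    show "sc c x \<in> m" if "x \<in> m" for c x
      using ideal_type_algD(4)[OF m that, of "sc c 1"] by (simp add: scale_one_mult)
  qed (auto intro: ideal_type_algD[OF m])
qed


section \<open>Finite groups acting on algebras\<close>

locale algebra_action = k_algebra sc + group G
  for sc :: "'k::field \<Rightarrow> 'a::{ring, monoid_mult} \<Rightarrow> 'a"
    and G :: "('g, 'm) monoid_scheme" (structure)
    and act :: "'g \<Rightarrow> 'a \<Rightarrow> 'a" +
  assumes finite_group: "finite (carrier G)"
    and acts: "acts_by_automorphisms G sc act"
begin

lemma act_hom: "g \<in> carrier G \<Longrightarrow> act g \<in> alg_hom (type_alg sc) (type_alg sc)"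
  using acts by (auto simp: acts_by_automorphisms_def alg_iso_def)

lemma
  assumes "g \<in> carrier G"
  shows act_add: "act g (x + y) = act g x + act g y"
    and act_mult: "act g (x * y) = act g x * act g y"
    and act_one: "act g 1 = 1"
    and act_scale: "act g (sc c x) = sc c (act g x)"
  using act_hom[OF assms] by (auto simp: alg_hom_type_alg_iff)

lemma act_linear: "g \<in> carrier G \<Longrightarrow> Vector_Spaces.linear sc sc (act g)"
  using act_add act_scale
  by (intro Vector_Spaces.linear.intro module_hom.intro module_hom_axioms.intro
      vector_space_axioms module_axioms) auto

lemma
  assumes "g \<in> carrier G"
  shows act_zero: "act g 0 = 0"
    and act_minus: "act g (- x) = - act g x"
    and act_diff: "act g (x - y) = act g x - act g y"
    and act_sum: "act g (sum u I) = (\<Sum>i\<in>I. act g (u i))"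
proof -
  interpret h: Vector_Spaces.linear sc sc "act g" by (rule act_linear) fact
  show "act g 0 = 0" "act g (- x) = - act g x" "act g (x - y) = act g x - act g y"
    "act g (sum u I) = (\<Sum>i\<in>I. act g (u i))"
    by (rule h.zero h.neg h.diff h.sum)+
qed

lemma act_comp: "g \<in> carrier G \<Longrightarrow> h \<in> carrier G \<Longrightarrow> act (g \<otimes> h) x = act g (act h x)"
  using acts group_action.composition_rule[of G UNIV act x g h]
  by (auto simp: acts_by_automorphisms_def)

lemma act_id: "act \<one> x = x"
  using acts group_action.id_eq_one[of G UNIV act]
  by (auto simp: acts_by_automorphisms_def fun_eq_iff)

lemma act_inv: "g \<in> carrier G \<Longrightarrow> act (inv g) (act g x) = x"
  and act_inv': "g \<in> carrier G \<Longrightarrow> act g (act (inv g) x) = x"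
  by (simp_all add: act_id flip: act_comp)

lemma sum_group_shift:
  assumes g: "g \<in> carrier G"
  shows "(\<Sum>h\<in>carrier G. F (g \<otimes> h)) = (\<Sum>h\<in>carrier G. F h)"
  by (rule sum.reindex_bij_witness[of _ "\<lambda>h. inv g \<otimes> h" "\<lambda>h. g \<otimes> h"])
    (use g in \<open>auto simp: m_assoc[symmetric]\<close>)

end

text \<open>
  The coefficients of a product of linear polynomials, written out as sums over subsets. The type of
  polynomials over \<open>A\<close> cannot carry this argument, since its ring structure asks for \<open>0 \<noteq> 1\<close> in \<open>A\<close>.
\<close>

lemma prod_add_Pow:
  fixes x :: "'a::{comm_ring, comm_monoid_mult}"
  assumes "finite X"
  shows "(\<Prod>s\<in>X. x + u s) = (\<Sum>Y\<in>Pow X. (\<Prod>s\<in>Y. u s) * x ^ (card X - card Y))"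
  using assms
proof (induction X rule: finite_induct)
  case (insert s X)
  have inj: "inj_on (insert s) (Pow X)"
    using insert.hyps by (auto simp: inj_on_def)
  have fin: "finite Y" "s \<notin> Y" "card Y \<le> card X" if "Y \<in> Pow X" for Y
    using that insert.hyps finite_subset card_mono by auto
  have "(\<Sum>Y\<in>Pow (insert s X). (\<Prod>s\<in>Y. u s) * x ^ (card (insert s X) - card Y))
      = (\<Sum>Y\<in>Pow X. (\<Prod>s\<in>Y. u s) * x ^ (Suc (card X) - card Y))
       + (\<Sum>Y\<in>insert s ` Pow X. (\<Prod>s\<in>Y. u s) * x ^ (Suc (card X) - card Y))"
    unfolding Pow_insert using insert.hyps
    by (subst sum.union_disjoint) auto
  also have "(\<Sum>Y\<in>Pow X. (\<Prod>s\<in>Y. u s) * x ^ (Suc (card X) - card Y))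
      = (\<Sum>Y\<in>Pow X. x * ((\<Prod>s\<in>Y. u s) * x ^ (card X - card Y)))"
    by (rule sum.cong) (auto simp: Suc_diff_le fin mult.left_commute)
  also have "(\<Sum>Y\<in>insert s ` Pow X. (\<Prod>s\<in>Y. u s) * x ^ (Suc (card X) - card Y))
      = (\<Sum>Y\<in>Pow X. u s * ((\<Prod>s\<in>Y. u s) * x ^ (card X - card Y)))"
    unfolding sum.reindex[OF inj] o_def
    by (rule sum.cong) (use fin in \<open>auto simp: mult.assoc\<close>)
  finally show ?case
    using insert by (simp add: distrib_right sum_distrib_left sum.distrib)
qed auto

locale commutative_algebra_action = algebra_action sc G act
  for sc :: "'k::field \<Rightarrow> 'a::{comm_ring, comm_monoid_mult} \<Rightarrow> 'a"
    and G :: "('g, 'm) monoid_scheme" (structure)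
    and act :: "'g \<Rightarrow> 'a \<Rightarrow> 'a"
begin

lemma act_prod: "g \<in> carrier G \<Longrightarrow> act g (prod u I) = (\<Prod>i\<in>I. act g (u i))"
  by (induction I rule: infinite_finite_induct) (auto simp: act_one act_mult)

text \<open>
  \<open>f\<close> is a root of \<open>\<Prod>g. (X - g f)\<close>, because the factor of the neutral element vanishes at \<open>f\<close>. The
  coefficients are invariant: \<open>G\<close> permutes the subsets of \<open>G\<close> of each cardinality by translation.
\<close>

lemma integral_over_invariants:
  obtains e where "e (Coset.order G) = 1" and "\<And>i g. g \<in> carrier G \<Longrightarrow> act g (e i) = e i"
    and "(\<Sum>i\<le>Coset.order G. e i * f ^ i) = 0"
proof -
  let ?n = "Coset.order G" and ?p = "\<lambda>Y. \<Prod>s\<in>Y. - act s f"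
  define e where "e i = (\<Sum>Y | Y \<in> Pow (carrier G) \<and> ?n - card Y = i. ?p Y)" for i
  have n: "card (carrier G) = ?n"
    by (simp add: Coset.order_def)
  have "{Y. Y \<in> Pow (carrier G) \<and> ?n - card Y = ?n} = {{}}"
  proof -
    have "Y = {}" if "Y \<subseteq> carrier G" "?n - card Y = ?n" for Y
    proof -
      have "finite Y" "card Y \<le> ?n"
        using that finite_group finite_subset card_mono n by metis+
      moreover have "?n > 0"
        using finite_group one_closed by (metis n card_gt_0_iff empty_iff)
      ultimately have "card Y = 0"
        using that by linarith
      then show ?thesis
        using \<open>finite Y\<close> by simp
    qed
    then show ?thesis by auto
  qed
  then have top: "e ?n = 1"
    by (simp add: e_def)
  have invariant: "act g (e i) = e i" if g: "g \<in> carrier G" for g i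
  proof -
    have p: "act g (?p Y) = ?p ((\<lambda>h. g \<otimes> h) ` Y)" if "Y \<in> Pow (carrier G)" for Y
    proof -
      have "inj_on (\<lambda>h. g \<otimes> h) Y"
        using that g by (auto simp: inj_on_def subset_iff)
      then have "?p ((\<lambda>h. g \<otimes> h) ` Y) = (\<Prod>s\<in>Y. - act (g \<otimes> s) f)"
        by (simp add: prod.reindex)
      also have "\<dots> = act g (?p Y)"
        using that g by (auto simp: act_prod act_minus act_comp intro!: prod.cong)
      finally show ?thesis ..
    qed
    have card: "card ((\<lambda>h. k \<otimes> h) ` Y) = card Y" if "Y \<subseteq> carrier G" "k \<in> carrier G" for Y k
      using that by (intro card_image) (auto simp: inj_on_def subset_iff)
    have inv: "(\<lambda>h. k \<otimes> h) ` (\<lambda>h. inv k \<otimes> h) ` Y = Y" if "Y \<subseteq> carrier G" "k \<in> carrier G" for Y k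
      using that by (force simp: image_image m_assoc[symmetric])
    have inv': "(\<lambda>h. inv k \<otimes> h) ` (\<lambda>h. k \<otimes> h) ` Y = Y" if "Y \<subseteq> carrier G" "k \<in> carrier G" for Y k
      using inv[of Y "inv k"] that by simp
    have "(\<Sum>Y | Y \<in> Pow (carrier G) \<and> ?n - card Y = i. ?p ((\<lambda>h. g \<otimes> h) ` Y)) = e i"
      unfolding e_def
      by (rule sum.reindex_bij_witness[of _ "\<lambda>Y. (\<lambda>h. inv g \<otimes> h) ` Y" "\<lambda>Y. (\<lambda>h. g \<otimes> h) ` Y"])
        (use g in \<open>auto simp: inv inv' card\<close>)
    moreover have "act g (e i) = (\<Sum>Y | Y \<in> Pow (carrier G) \<and> ?n - card Y = i. act g (?p Y))"
      unfolding e_def act_sum[OF g] ..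
    moreover have "\<dots> = (\<Sum>Y | Y \<in> Pow (carrier G) \<and> ?n - card Y = i. ?p ((\<lambda>h. g \<otimes> h) ` Y))"
      by (rule sum.cong) (simp_all only: mem_Collect_eq p)
    ultimately show ?thesis by simp
  qed
  have "(\<Prod>s\<in>carrier G. f + - act s f) = 0"
  proof -
    have "(\<Prod>s\<in>carrier G. f + - act s f) = (f + - act \<one> f) * (\<Prod>s\<in>carrier G - {\<one>}. f + - act s f)"
      by (rule prod.remove) (use finite_group in auto)
    then show ?thesis
      by (simp add: act_id)
  qed
  then have "(\<Sum>Y\<in>Pow (carrier G). ?p Y * f ^ (?n - card Y)) = 0"
    using prod_add_Pow[OF finite_group, of f "\<lambda>s. - act s f"] by (simp add: n)
  also have "(\<Sum>Y\<in>Pow (carrier G). ?p Y * f ^ (?n - card Y))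
      = (\<Sum>i\<le>?n. \<Sum>Y | Y \<in> Pow (carrier G) \<and> ?n - card Y = i. ?p Y * f ^ (?n - card Y))"
    by (rule sum.group[symmetric]) (use finite_group in auto)
  also have "\<dots> = (\<Sum>i\<le>?n. e i * f ^ i)"
    unfolding e_def sum_distrib_right by (intro sum.cong) auto
  finally have "(\<Sum>i\<le>?n. e i * f ^ i) = 0" .
  with top invariant show ?thesis
    by (rule that)
qed

end


section \<open>Irreducible traces\<close>

text \<open>
  For an irreducible representation \<open>\<rho>\<close> of the equivariant map algebra, put
  \<open>t b f = \<rho> (\<Sum>g. g \<cdot> (b \<otimes> f))\<close>. The axioms below collect the identities that \<open>t\<close> inherits from
  \<open>\<rho>\<close>. They suffice to find the point at which \<open>\<rho>\<close> is supported, and they speak of \<open>\<aa>\<close> and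
  \<open>A\<close> separately instead of their tensor product.
\<close>

locale irreducible_trace =
  A: commutative_algebra_action scA G actA + B: algebra_action scB G actB +
  V: irreducible_operators scV Basis "range (\<lambda>(b, f). t b f)"
  for scA :: "'k::alg_closed_field \<Rightarrow> 'a::{comm_ring, comm_monoid_mult} \<Rightarrow> 'a"
    and scB :: "'k \<Rightarrow> 'b::{ring, monoid_mult} \<Rightarrow> 'b"
    and G :: "('g, 'm) monoid_scheme" (structure)
    and actA :: "'g \<Rightarrow> 'a \<Rightarrow> 'a"
    and actB :: "'g \<Rightarrow> 'b \<Rightarrow> 'b"
    and scV :: "'k \<Rightarrow> 'v::ab_group_add \<Rightarrow> 'v"
    and Basis
    and t :: "'b \<Rightarrow> 'a \<Rightarrow> 'v \<Rightarrow> 'v" +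
  assumes order_nonzero: "of_nat (Coset.order G) \<noteq> (0::'k)"
    and t_add: "t b (f + f') v = t b f v + t b f' v"
    and t_scale: "t b (scA c f) v = scV c (t b f v)"
    and t_equivariant: "g \<in> carrier G \<Longrightarrow> t (actB g b) (actA g f) = t b f"
    and t_mult: "t b f (t b' f' v) = (\<Sum>h\<in>carrier G. t (b * actB h b') (f * actA h f') v)"
    and t_one: "t 1 1 v = scV (of_nat (Coset.order G)) v"
begin

lemma t_linear: "Vector_Spaces.linear scV scV (t b f)"
  by (rule V.operator_linear) auto

lemma t_zero: "t b 0 v = 0" and t_minus: "t b (- f) v = - t b f v"
proof -
  show zero: "t b 0 v = 0"
    using t_add[of b 0 0 v] by simp
  show "t b (- f) v = - t b f v"
    using t_add[of b f "- f" v] zero by (simp add: minus_unique)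
qed

text \<open>
  The factor \<open>h\<close> makes this set an ideal. If \<open>\<aa> = k\<close> with trivial action, for instance, \<open>t b f\<close>
  already vanishes when \<open>f\<close> has trace \<open>0\<close>, and such \<open>f\<close> need not form an ideal.
\<close>

definition trace_kernel :: "'a set" where
  "trace_kernel = {f. \<forall>b h v. t b (f * h) v = 0}"

lemma trace_kernelD: "f \<in> trace_kernel \<Longrightarrow> t b f v = 0"
  unfolding trace_kernel_def by (metis (mono_tags, lifting) mem_Collect_eq mult.right_neutral)

lemma ideal_trace_kernel: "ideal trace_kernel (type_alg scA)"
  unfolding ideal_type_alg_iff
  by (auto simp: trace_kernel_def t_zero t_add distrib_right mult.assoc)

lemmas trace_kernel_ideal = ideal_type_algD[OF ideal_trace_kernel]

lemma one_notin_trace_kernel: "1 \<notin> trace_kernel"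
proof
  assume *: "1 \<in> trace_kernel"
  have "v = 0" for v :: 'v
    using trace_kernelD[OF *, of 1 v] order_nonzero by (simp add: t_one)
  then show False
    using V.nonzero_space by auto
qed

text \<open>
  Suppose that \<open>t b f \<noteq> 0\<close> and \<open>u = t b' f' v' \<noteq> 0\<close> with \<open>f \<in> J\<close> and \<open>f' \<in> J'\<close>. The vectors
  \<open>t d h u\<close> span an invariant subspace, hence everything. But \<open>t b f\<close> kills each of them: in the
  expansion of \<open>t b f (t d h u)\<close> every second argument is a product of \<open>f\<close> with an element of
  the stable ideal \<open>J'\<close>, and so it lies in the trace kernel.
\<close>

lemma trace_kernel_group_prime:
  assumes J: "ideal J (type_alg scA)" and J': "ideal J' (type_alg scA)"
    and stable: "\<And>g f. g \<in> carrier G \<Longrightarrow> f \<in> J' \<Longrightarrow> actA g f \<in> J'"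
    and prod: "\<And>f f'. f \<in> J \<Longrightarrow> f' \<in> J' \<Longrightarrow> f * f' \<in> trace_kernel"
  shows "J \<subseteq> trace_kernel \<or> J' \<subseteq> trace_kernel"
proof (rule ccontr)
  assume contr: "\<not> ?thesis"
  then obtain f b v where f: "f \<in> J" "t b f v \<noteq> 0"
    unfolding trace_kernel_def using ideal_type_algD(3)[OF J] by blast
  obtain f' b' v' where f': "f' \<in> J'" "t b' f' v' \<noteq> 0"
    using contr unfolding trace_kernel_def using ideal_type_algD(3)[OF J'] by blast
  define u where "u = t b' f' v'"
  interpret T: Vector_Spaces.linear scV scV "t b f" by (rule t_linear)
  have zero: "t b f (t d h u) = 0" for d h
  proof -
    have "t b f (t d h u) = (\<Sum>k\<in>carrier G. t b f (t (d * actB k b') (h * actA k f') v'))"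
      unfolding u_def t_mult[of d h b' f' v'] by (rule T.sum)
    also have "\<dots> = 0"
    proof (intro sum.neutral ballI)
      fix k assume k: "k \<in> carrier G"
      have "f * actA l (h * actA k f') \<in> trace_kernel" if "l \<in> carrier G" for l
        by (intro prod f(1) stable that ideal_type_algD(4)[OF J'] k f'(1))
      then show "t b f (t (d * actB k b') (h * actA k f') v') = 0"
        unfolding t_mult by (intro sum.neutral ballI trace_kernelD) auto
    qed
    finally show ?thesis .
  qed
  let ?W = "V.span (range (\<lambda>(d, h). t d h u))"
  have "t d h ` ?W \<subseteq> ?W" for d h
  proof -
    interpret U: Vector_Spaces.linear scV scV "t d h" by (rule t_linear)
    have "t d h (t d' h' u) \<in> ?W" for d' h'
      unfolding t_mult by (intro V.span_sum V.span_base) auto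
    then have "t d h ` range (\<lambda>(d, h). t d h u) \<subseteq> ?W"
      by auto
    then show ?thesis
      by (metis U.span_image V.span_minimal V.subspace_span)
  qed
  then have "?W = {0} \<or> ?W = UNIV"
    by (intro V.invariant_trivial) auto
  moreover have "t 1 1 u \<in> ?W"
    by (rule V.span_base) auto
  moreover have "t 1 1 u \<noteq> 0"
    using order_nonzero f' by (simp add: u_def t_one)
  ultimately have "v \<in> ?W"
    by auto
  then have "t b f v = 0"
    by (rule T.eq_0_on_span[rotated]) (use zero in auto)
  then show False
    using f by simp
qed

text \<open>
  For invariant \<open>n\<close> the operator \<open>t 1 n\<close> commutes with every \<open>t b f\<close>, so it is a scalar by Schur's
  lemma, like \<open>t 1 1\<close>, which is the multiplication by \<open>|G|\<close>. Hence \<open>t 1 (n - c) = 0\<close> for some \<open>c\<close>, and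
  \<open>t 1 (n - c) \<circ> t b h\<close> is \<open>|G|\<close> times \<open>t b ((n - c) h)\<close>.
\<close>

lemma invariant_scalar_mod_trace_kernel:
  assumes n: "\<And>g. g \<in> carrier G \<Longrightarrow> actA g n = n"
  shows "\<exists>c. n - scA c 1 \<in> trace_kernel"
proof -
  let ?N = "of_nat (Coset.order G) :: 'k"
  have right: "t b f (t 1 n v) = scV ?N (t b (n * f) v)" for b f v
    by (simp add: t_mult n B.act_one mult.commute V.sum_constant_scale Coset.order_def)
  have left: "t 1 n (t b f v) = scV ?N (t b (n * f) v)" for b f v
  proof -
    have "t (1 * actB h b) (n * actA h f) v = t b (n * f) v" if h: "h \<in> carrier G" for h
      using t_equivariant[OF h, of b "n * f"] by (simp add: A.act_mult[OF h] n[OF h])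
    then show ?thesis
      by (simp add: t_mult V.sum_constant_scale Coset.order_def)
  qed
  obtain a where a: "\<And>v. t 1 n v = scV a v"
    using V.schur[OF t_linear, of 1 n] left right by force
  let ?c = "a / ?N"
  have zero: "t 1 (n - scA ?c 1) v = 0" for v
    using order_nonzero t_add[of 1 n "- scA ?c 1" v] by (simp add: t_minus t_scale a t_one)
  have inv: "actA g (n - scA ?c 1) = n - scA ?c 1" if "g \<in> carrier G" for g
    using that by (simp add: A.act_diff A.act_scale A.act_one n)
  have "t b ((n - scA ?c 1) * h) v = 0" for b h v
  proof -
    have "t (1 * actB k b) ((n - scA ?c 1) * actA k h) v = t b ((n - scA ?c 1) * h) v"
      if k: "k \<in> carrier G" for k
      using t_equivariant[OF k, of b "(n - scA ?c 1) * h"] by (simp add: A.act_mult[OF k] inv[OF k])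
    then have "t 1 (n - scA ?c 1) (t b h v) = scV ?N (t b ((n - scA ?c 1) * h) v)"
      by (simp add: t_mult V.sum_constant_scale Coset.order_def)
    then show ?thesis
      using zero order_nonzero by simp
  qed
  then show ?thesis
    unfolding trace_kernel_def by blast
qed

text \<open>
  Replace the invariant coefficients of the integral equation of \<open>f\<close> by the scalars to which they are
  congruent.
\<close>

lemma algebraic_mod_trace_kernel:
  "\<exists>p. p \<noteq> 0 \<and> poly_apply scA (\<lambda>y. f * y) 1 p \<in> trace_kernel"
proof -
  let ?n = "Coset.order G"
  obtain e where e: "e ?n = 1" "\<And>i g. g \<in> carrier G \<Longrightarrow> actA g (e i) = e i"
      "(\<Sum>i\<le>?n. e i * f ^ i) = 0"
    using A.integral_over_invariants[of f] by blast
  \<comment> \<open>The leading coefficient is kept equal to \<open>1\<close>, so that the new polynomial is nonzero.\<close>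
  have "\<exists>c. e i - scA c 1 \<in> trace_kernel \<and> (i = ?n \<longrightarrow> c = 1)" for i
  proof (cases "i = ?n")
    case True
    then show ?thesis
      using e(1) trace_kernel_ideal(1) by (intro exI[of _ 1]) simp
  next
    case False
    then show ?thesis
      using invariant_scalar_mod_trace_kernel[OF e(2)] by blast
  qed
  then obtain c where c: "\<And>i. e i - scA (c i) 1 \<in> trace_kernel" "c ?n = 1"
    by metis
  let ?p = "\<Sum>i\<le>?n. monom (c i) i"
  have pow: "((\<lambda>y. f * y) ^^ i) 1 = f ^ i" for i
    by (induction i) auto
  have "(\<Sum>i\<le>?n. (e i - scA (c i) 1) * f ^ i) \<in> trace_kernel"
    by (intro ideal_type_alg_sum[OF ideal_trace_kernel] trace_kernel_ideal(3) c(1))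
  also have "(\<Sum>i\<le>?n. (e i - scA (c i) 1) * f ^ i) = - (\<Sum>i\<le>?n. scA (c i) (f ^ i))"
    by (simp add: left_diff_distrib A.scale_one_mult sum_subtractf e(3))
  also have "(\<Sum>i\<le>?n. scA (c i) (f ^ i)) = poly_apply scA (\<lambda>y. f * y) 1 ?p"
    by (simp add: A.poly_apply_sum_monom pow)
  finally have "poly_apply scA (\<lambda>y. f * y) 1 ?p \<in> trace_kernel"
    using trace_kernel_ideal(5) by fastforce
  moreover have "coeff ?p ?n \<noteq> 0"
    by (simp add: coeff_sum_monom c(2))
  then have "?p \<noteq> 0"
    by (metis coeff_0)
  ultimately show ?thesis
    by (intro exI[of _ ?p] conjI)
qed

text \<open>The intersection of the translates of \<open>m\<close>: if \<open>m\<close> is an ideal, the largest stable ideal in it.\<close>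

definition group_core :: "'a set \<Rightarrow> 'a set" where
  "group_core m = {f. \<forall>g\<in>carrier G. actA g f \<in> m}"

lemma ideal_group_core:
  assumes "ideal m (type_alg scA)"
  shows "ideal (group_core m) (type_alg scA)"
  unfolding ideal_type_alg_iff group_core_def
  by (auto simp: A.act_zero A.act_add A.act_mult intro: ideal_type_algD(1-3)[OF assms])

lemma group_core_stable: "g \<in> carrier G \<Longrightarrow> f \<in> group_core m \<Longrightarrow> actA g f \<in> group_core m"
  by (auto simp: group_core_def simp flip: A.act_comp)

text \<open>
  Zorn's lemma applies because \<open>G\<close> is finite: if \<open>f\<close> is in the core of the union of a chain, the finitely
  many translates of \<open>f\<close> lie in a single member of the chain.
\<close>

lemma maximal_ideal_with_small_core:
  obtains m where "ideal m (type_alg scA)" "trace_kernel \<subseteq> m" "group_core m \<subseteq> trace_kernel"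
    and "\<And>m'. ideal m' (type_alg scA) \<Longrightarrow> m \<subseteq> m' \<Longrightarrow> group_core m' \<subseteq> trace_kernel \<Longrightarrow> m' = m"
proof -
  let ?F = "{m. ideal m (type_alg scA) \<and> trace_kernel \<subseteq> m \<and> group_core m \<subseteq> trace_kernel}"
  have "group_core trace_kernel \<subseteq> trace_kernel"
    by (auto simp: group_core_def A.act_id dest: bspec[OF _ A.one_closed])
  then have ne: "?F \<noteq> {}"
    using ideal_trace_kernel by blast
  have "\<Union>C \<in> ?F" if C: "C \<noteq> {}" "subset.chain ?F C" for C
  proof -
    have CF: "C \<subseteq> ?F" and total: "\<And>x y. x \<in> C \<Longrightarrow> y \<in> C \<Longrightarrow> x \<subseteq> y \<or> y \<subseteq> x"
      using C(2) by (auto simp: subset_chain_def)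
    have CI: "ideal m (type_alg scA)" if "m \<in> C" for m
      using that CF by auto
    have "ideal (\<Union>C) (type_alg scA)"
      unfolding ideal_type_alg_iff
    proof (intro conjI ballI allI)
      show "0 \<in> \<Union>C"
        using C(1) ideal_type_algD(1)[OF CI] by auto
      show "x * a \<in> \<Union>C" if "x \<in> \<Union>C" for x a
        using that ideal_type_algD(3)[OF CI] by blast
      show "x + y \<in> \<Union>C" if xy: "x \<in> \<Union>C" "y \<in> \<Union>C" for x y
      proof -
        obtain m where "m \<in> C" "x \<in> m" "y \<in> m"
          using xy total by blast
        then show ?thesis
          using ideal_type_algD(2)[OF CI] by blast
      qed
    qed
    moreover have "group_core (\<Union>C) \<subseteq> trace_kernel"
    proof
      fix f assume "f \<in> group_core (\<Union>C)"
      then have "(\<lambda>g. actA g f) ` carrier G \<subseteq> \<Union>C"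
        by (auto simp: group_core_def)
      then obtain m where "m \<in> C" "(\<lambda>g. actA g f) ` carrier G \<subseteq> m"
        using finite_subset_Union_chain[OF finite_imageI[OF A.finite_group] _ C] by metis
      then have "f \<in> group_core m"
        by (auto simp: group_core_def)
      then show "f \<in> trace_kernel"
        using CF \<open>m \<in> C\<close> by blast
    qed
    ultimately show ?thesis
      using C(1) CF by blast
  qed
  then have "\<exists>m\<in>?F. \<forall>m'\<in>?F. m \<subseteq> m' \<longrightarrow> m' = m"
    by (rule subset_Zorn_nonempty[OF ne])
  then obtain m where m: "m \<in> ?F" "\<forall>m'\<in>?F. m \<subseteq> m' \<longrightarrow> m' = m"
    by (rule bexE)
  show ?thesis
  proof (rule that)
    show "m' = m" if "ideal m' (type_alg scA)" "m \<subseteq> m'" "group_core m' \<subseteq> trace_kernel" for m'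
    proof -
      have "m' \<in> ?F"
        using m(1) that by simp (meson subset_trans)
      then show ?thesis
        using m(2) that(2) by blast
    qed
  qed (use m(1) in simp_all)
qed

text \<open>
  The ideal \<open>m\<close> of the previous lemma is prime. Indeed, let \<open>f f' \<in> m\<close> with \<open>f, f' \<notin> m\<close>. By
  maximality the cores of \<open>m + (f)\<close> and \<open>m + (f')\<close> are not contained in the trace kernel, although
  their product is contained in the core of \<open>m\<close> and so in the trace kernel; this contradicts
  \<open>trace_kernel_group_prime\<close>. Since every function is algebraic over \<open>k\<close> modulo the trace kernel,
  which is part of \<open>m\<close>, every function is a scalar modulo the prime ideal \<open>m\<close>, and \<open>\<chi>\<close> is this
  scalar. A function all of whose translates have value \<open>0\<close> is in the core of \<open>m\<close>.
\<close>

theorem character_controls_trace: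
  obtains \<chi> where "\<chi> \<in> alg_hom (type_alg scA) (type_alg (*))"
    and "\<And>b f v. (\<And>g. g \<in> carrier G \<Longrightarrow> \<chi> (actA g f) = 0) \<Longrightarrow> t b f v = 0"
proof -
  obtain m where m: "ideal m (type_alg scA)" "trace_kernel \<subseteq> m" "group_core m \<subseteq> trace_kernel"
    and max: "\<And>m'. ideal m' (type_alg scA) \<Longrightarrow> m \<subseteq> m' \<Longrightarrow> group_core m' \<subseteq> trace_kernel \<Longrightarrow> m' = m"
    using maximal_ideal_with_small_core by blast
  note mI = ideal_type_algD[OF m(1)]
  have one: "1 \<notin> m"
  proof
    assume "1 \<in> m"
    then have "1 \<in> group_core m"
      by (simp add: group_core_def A.act_one)
    then show False
      using m(3) one_notin_trace_kernel by blast
  qed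
  have prime: "f \<in> m" if ff': "f * f' \<in> m" and "f' \<notin> m" for f f'
  proof (rule ccontr)
    assume "f \<notin> m"
    define extend where "extend x = {y + x * a |y a. y \<in> m}" for x
    have ideal_ext: "ideal (extend x) (type_alg scA)" for x
      unfolding ideal_type_alg_iff
    proof (intro conjI ballI allI)
      show "0 \<in> extend x"
        unfolding extend_def using mI(1) by (intro CollectI exI[of _ 0]) auto
      show "y + z \<in> extend x" if yz: "y \<in> extend x" "z \<in> extend x" for y z
      proof -
        obtain y' a z' b where "y' \<in> m" "y = y' + x * a" "z' \<in> m" "z = z' + x * b"
          using yz by (auto simp: extend_def)
        then show ?thesis
          unfolding extend_def using mI(2)
          by (intro CollectI exI[of _ "y' + z'"] exI[of _ "a + b"]) (auto simp: algebra_simps)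
      qed
      show "y * b \<in> extend x" if y: "y \<in> extend x" for y b
      proof -
        obtain y' a where "y' \<in> m" "y = y' + x * a"
          using y by (auto simp: extend_def)
        then show ?thesis
          unfolding extend_def using mI(3)
          by (intro CollectI exI[of _ "y' * b"] exI[of _ "a * b"]) (simp add: distrib_right mult.assoc)
      qed
    qed
    have m_ext: "m \<subseteq> extend x" for x
    proof
      fix y assume "y \<in> m"
      then show "y \<in> extend x"
        unfolding extend_def by (intro CollectI exI[of _ y] exI[of _ 0]) simp
    qed
    have "x \<in> extend x" for x
      unfolding extend_def using mI(1) by (intro CollectI exI[of _ 0] exI[of _ 1]) auto
    then have big: "\<not> group_core (extend x) \<subseteq> trace_kernel" if "x \<notin> m" for x
      using max[OF ideal_ext m_ext] that by blast
    have "y * z \<in> trace_kernel" if yz: "y \<in> group_core (extend f)" "z \<in> group_core (extend f')" for y z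
    proof -
      have "actA g (y * z) \<in> m" if g: "g \<in> carrier G" for g
      proof -
        obtain y' a z' b where yz': "y' \<in> m" "actA g y = y' + f * a" "z' \<in> m" "actA g z = z' + f' * b"
          using yz g unfolding group_core_def extend_def by blast
        have "actA g (y * z) = y' * (z' + f' * b) + z' * (f * a) + (f * f') * (a * b)"
          by (simp add: A.act_mult[OF g] yz' algebra_simps)
        then show ?thesis
          using mI(2,3) yz' ff' by simp
      qed
      then show ?thesis
        using m(3) by (auto simp: group_core_def)
    qed
    then show False
      using trace_kernel_group_prime[of "group_core (extend f)" "group_core (extend f')"]
        ideal_group_core[OF ideal_ext] group_core_stable big \<open>f \<notin> m\<close> \<open>f' \<notin> m\<close> by blast
  qed
  have "\<exists>a. f - scA a 1 \<in> m" for f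
  proof -
    obtain p where "p \<noteq> 0" "poly_apply scA (\<lambda>y. f * y) 1 p \<in> m"
      using algebraic_mod_trace_kernel[of f] m(2) by blast
    moreover have "Vector_Spaces.linear scA scA (\<lambda>y. f * y)"
      by (intro Vector_Spaces.linear.intro module_hom.intro module_hom_axioms.intro
          A.vector_space_axioms A.module_axioms) (simp_all add: distrib_left A.scale_mult_right)
    ultimately obtain w a where w: "w \<notin> m" "f * w - scA a w \<in> m"
      using eigenvector_modulo_subspace[OF A.vector_space_axioms _
          ideal_type_alg_subspace[OF A.k_algebra_axioms m(1)] one] by blast
    then have "(f - scA a 1) * w \<in> m"
      by (simp add: left_diff_distrib A.scale_one_mult)
    then show ?thesis
      using prime w(1) by blast
  qed
  then obtain \<chi> where \<chi>: "\<And>f. f - scA (\<chi> f) 1 \<in> m"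
    by metis
  have uniq: "\<chi> f = c" if "f - scA c 1 \<in> m" for f c
  proof (rule ccontr)
    assume "\<chi> f \<noteq> c"
    have "(f - scA c 1) - (f - scA (\<chi> f) 1) \<in> m"
      by (rule mI(6)[OF that \<chi>])
    then have "scA (\<chi> f - c) 1 * scA (inverse (\<chi> f - c)) 1 \<in> m"
      by (intro mI(3)) (simp add: A.scale_left_diff_distrib)
    then show False
      using one \<open>\<chi> f \<noteq> c\<close> by (simp add: A.scale_one_mult)
  qed
  have "\<chi> (f + g) = \<chi> f + \<chi> g" for f g
    using mI(2)[OF \<chi>[of f] \<chi>[of g]] by (intro uniq) (simp add: A.scale_left_distrib algebra_simps)
  moreover have "\<chi> (f * g) = \<chi> f * \<chi> g" for f g
  proof (rule uniq)
    have "(f - scA (\<chi> f) 1) * g + (g - scA (\<chi> g) 1) * scA (\<chi> f) 1 \<in> m"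
      by (intro mI(2,3) \<chi>)
    then show "f * g - scA (\<chi> f * \<chi> g) 1 \<in> m"
      by (simp add: left_diff_distrib A.scale_mult_left A.scale_mult_right A.scale_right_diff_distrib)
  qed
  moreover have "\<chi> 1 = 1"
    using mI(1) by (intro uniq) simp
  moreover have "\<chi> (scA c f) = c * \<chi> f" for c f
  proof (rule uniq)
    have "(f - scA (\<chi> f) 1) * scA c 1 \<in> m"
      by (intro mI(3) \<chi>)
    then show "scA c f - scA (c * \<chi> f) 1 \<in> m"
      by (simp add: left_diff_distrib A.scale_mult_left A.scale_mult_right A.scale_right_diff_distrib)
  qed
  ultimately have "\<chi> \<in> alg_hom (type_alg scA) (type_alg (*))"
    by (simp add: alg_hom_type_alg_iff)
  moreover have "t b f v = 0" if "\<And>g. g \<in> carrier G \<Longrightarrow> \<chi> (actA g f) = 0" for b f v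
  proof -
    have "actA g f \<in> m" if g: "g \<in> carrier G" for g
      using \<chi>[of "actA g f"] \<open>\<And>g. g \<in> carrier G \<Longrightarrow> \<chi> (actA g f) = 0\<close>[OF g] by simp
    then have "f \<in> trace_kernel"
      using m(3) by (auto simp: group_core_def)
    then show ?thesis
      by (rule trace_kernelD)
  qed
  ultimately show ?thesis
    by (rule that)
qed

end


section \<open>Quotients by ideals\<close>

text \<open>This covers both the tensor product, as a quotient of the free algebra, and the residue field
  of a point, as a quotient of \<open>A\<close>.\<close>

locale full_ring_quotient = ideal I B
  for B :: "('k::field, 'c::ab_group_add) module" and I +
  assumes full_carrier: "carrier B = UNIV" and full_add: "(\<oplus>\<^bsub>B\<^esub>) = (+)"
begin

abbreviation coset :: "'c \<Rightarrow> 'c set" where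
  "coset p \<equiv> I +>\<^bsub>B\<^esub> p"

lemma full_zero: "\<zero>\<^bsub>B\<^esub> = 0"
  using l_zero[of 0] by (simp add: full_carrier full_add)

lemma full_minus: "\<ominus>\<^bsub>B\<^esub> p = - p"
  by (rule minus_equality) (simp_all add: full_carrier full_add full_zero)

lemma I_zero: "0 \<in> I"
  using additive_subgroup.zero_closed[OF additive_subgroup_axioms] by (simp add: full_zero)

lemma coset_eq_iff: "coset p = coset q \<longleftrightarrow> p - q \<in> I"
  using quotient_eq_iff_same_a_r_cos[OF ideal_axioms, of p q]
  by (simp add: full_carrier full_add full_minus a_minus_def)

lemma coset_eqI: "p - q \<in> I \<Longrightarrow> coset p = coset q"
  by (simp add: coset_eq_iff)

lemma mem_coset_iff: "p \<in> coset q \<longleftrightarrow> p - q \<in> I"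
  by (auto simp: a_r_coset_def' full_add intro: bexI[of _ "p - q"])

lemma quot_carrier: "carrier (quot_alg B I) = range coset"
  by (auto simp: quot_alg_def FactRing_def A_RCOSETS_def' full_carrier)

lemma quot_mult: "coset p \<otimes>\<^bsub>quot_alg B I\<^esub> coset q = coset (p \<otimes>\<^bsub>B\<^esub> q)"
  by (simp add: quot_alg_def FactRing_def rcoset_mult_add full_carrier)

lemma quot_add: "coset p \<oplus>\<^bsub>quot_alg B I\<^esub> coset q = coset (p + q)"
  by (simp add: quot_alg_def FactRing_def a_rcos_sum full_carrier full_add)

lemma quot_one: "\<one>\<^bsub>quot_alg B I\<^esub> = coset \<one>\<^bsub>B\<^esub>"
  by (simp add: quot_alg_def FactRing_def)

lemma Union_coset_image:
  assumes F: "additive F" and I: "\<And>p. p \<in> I \<Longrightarrow> F p \<in> I"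
  shows "(\<Union>q\<in>coset p. coset (F q)) = coset (F p)"
proof -
  have "coset (F q) = coset (F p)" if "q \<in> coset p" for q
    using I[of "q - p"] that by (simp add: mem_coset_iff coset_eq_iff additive.diff[OF F])
  moreover have "p \<in> coset p"
    by (simp add: mem_coset_iff I_zero)
  ultimately show ?thesis by blast
qed

lemma quot_smult:
  assumes "additive (\<lambda>p. c \<odot>\<^bsub>B\<^esub> p)" and "\<And>p. p \<in> I \<Longrightarrow> c \<odot>\<^bsub>B\<^esub> p \<in> I"
  shows "c \<odot>\<^bsub>quot_alg B I\<^esub> coset p = coset (c \<odot>\<^bsub>B\<^esub> p)"
  using Union_coset_image[OF assms] by (simp add: quot_alg_def)

lemma the_elem_coset_image:
  assumes F: "additive F" and I: "\<And>p. p \<in> I \<Longrightarrow> F p = 0"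
  shows "the_elem (F ` coset p) = F p"
proof -
  have "F q = F p" if "q \<in> coset p" for q
    using I[of "q - p"] that by (simp add: mem_coset_iff additive.diff[OF F])
  moreover have "p \<in> coset p"
    by (simp add: mem_coset_iff I_zero)
  ultimately have "F ` coset p = {F p}" by blast
  then show ?thesis by simp
qed

end


section \<open>Rational points and characters\<close>

lemma additiveI: "(\<And>x y. F (x + y) = F x + F y) \<Longrightarrow> additive F"
  by (rule additive.intro)

context
  fixes sc :: "'k::field \<Rightarrow> 'a::{comm_ring, comm_monoid_mult} \<Rightarrow> 'a"
  assumes alg: "k_algebra sc"
begin

interpretation k_algebra sc by (rule alg)

lemma full_ring_quotient_type_alg:
  "ideal x (type_alg sc) \<Longrightarrow> full_ring_quotient (type_alg sc) x"
  by (intro full_ring_quotient.intro full_ring_quotient_axioms.intro) (auto intro!: ext)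

lemma type_alg_quot_smult:
  assumes x: "ideal x (type_alg sc)"
  shows "c \<odot>\<^bsub>quot_alg (type_alg sc) x\<^esub> (x +>\<^bsub>type_alg sc\<^esub> f) = x +>\<^bsub>type_alg sc\<^esub> sc c f"
proof -
  interpret full_ring_quotient "type_alg sc" x by (rule full_ring_quotient_type_alg[OF x])
  have "sc c p \<in> x" if "p \<in> x" for p
    using subspace_scale[OF ideal_type_alg_subspace[OF alg x] that] .
  then show ?thesis
    using quot_smult[of c f] by (simp add: additiveI scale_right_distrib)
qed

text \<open>
  Rational points are the same as algebra homomorphisms from \<open>A\<close> to \<open>k\<close>, a point being the kernel of
  the homomorphism. The homomorphism is recovered from its kernel because \<open>f - \<chi>(f)\<close> is in it.
\<close>

lemma value_at_character:
  assumes "k_rational_point sc x"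
  shows "value_at sc x \<in> alg_hom (type_alg sc) (type_alg (*))"
    and "value_at sc x f = 0 \<longleftrightarrow> f \<in> x"
proof -
  have x: "ideal x (type_alg sc)"
    using assms by (simp add: k_rational_point_def primeideal_def)
  interpret full_ring_quotient "type_alg sc" x by (rule full_ring_quotient_type_alg[OF x])
  define h where "h = (SOME h. h \<in> alg_iso (quot_alg (type_alg sc) x) (type_alg ((*) :: 'k \<Rightarrow> 'k \<Rightarrow> 'k)))"
  have "\<exists>h. h \<in> alg_iso (quot_alg (type_alg sc) x) (type_alg ((*) :: 'k \<Rightarrow> 'k \<Rightarrow> 'k))"
    using assms by (auto simp: k_rational_point_def)
  then have h: "h \<in> alg_iso (quot_alg (type_alg sc) x) (type_alg (*))"
    unfolding h_def by (rule someI_ex)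
  have v: "value_at sc x f = h (coset f)" for f
    by (simp add: value_at_def h_def)
  have hom: "h \<in> ring_hom (quot_alg (type_alg sc) x) (type_alg (*))"
    and smult: "\<And>c C. C \<in> range coset \<Longrightarrow> h (c \<odot>\<^bsub>quot_alg (type_alg sc) x\<^esub> C) = c * h C"
    and inj: "inj_on h (range coset)"
    using h by (auto simp: alg_iso_def alg_hom_def bij_betw_def quot_carrier)
  have add: "h (coset (f + g)) = h (coset f) + h (coset g)" for f g
    using ring_hom_add[OF hom, of "coset f" "coset g"] by (simp add: quot_carrier quot_add)
  have "h (coset (f * g)) = h (coset f) * h (coset g)" for f g
    using ring_hom_mult[OF hom, of "coset f" "coset g"] by (simp add: quot_carrier quot_mult)
  moreover have "h (coset 1) = 1"
    using ring_hom_one[OF hom] by (simp add: quot_one)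
  moreover have "h (coset (sc c f)) = c * h (coset f)" for c f
    using smult[of "coset f" c] by (simp add: type_alg_quot_smult[OF x])
  ultimately show "value_at sc x \<in> alg_hom (type_alg sc) (type_alg (*))"
    using add by (simp add: alg_hom_type_alg_iff v)
  have "h (coset 0) = 0"
    using additive.zero[OF additiveI, of "\<lambda>f. h (coset f)"] add by simp
  then have "value_at sc x f = 0 \<longleftrightarrow> coset f = coset 0"
    using inj by (metis inj_onD rangeI v)
  then show "value_at sc x f = 0 \<longleftrightarrow> f \<in> x"
    by (simp add: coset_eq_iff)
qed

lemma character_point:
  assumes \<chi>: "\<chi> \<in> alg_hom (type_alg sc) (type_alg (*))"
  defines "x \<equiv> {f. \<chi> f = 0}"
  shows "k_rational_point sc x" and "value_at sc x = \<chi>"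
proof -
  have hom: "\<chi> (f + g) = \<chi> f + \<chi> g" "\<chi> (f * g) = \<chi> f * \<chi> g" "\<chi> 1 = 1" "\<chi> (sc c f) = c * \<chi> f" for f g c
    using \<chi> by (auto simp: alg_hom_type_alg_iff)
  have add: "additive \<chi>"
    by (rule additiveI) (rule hom)
  have x: "ideal x (type_alg sc)"
    using additive.zero[OF add] by (auto simp: ideal_type_alg_iff x_def hom)
  interpret full_ring_quotient "type_alg sc" x by (rule full_ring_quotient_type_alg[OF x])
  have "1 \<notin> x"
    by (simp add: x_def hom)
  then have "carrier (type_alg sc) \<noteq> x"
    by auto
  then have prime: "primeideal x (type_alg sc)"
    by (intro primeidealI x cring_type_alg) (auto simp: x_def hom)
  define h where "h C = the_elem (\<chi> ` C)" for C
  have h: "h (coset f) = \<chi> f" for f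
    unfolding h_def by (rule the_elem_coset_image[OF add]) (simp add: x_def)
  have "h \<in> alg_hom (quot_alg (type_alg sc) x) (type_alg (*))"
    by (auto simp: alg_hom_def ring_hom_def quot_carrier quot_mult quot_add quot_one h hom
        type_alg_quot_smult[OF x])
  moreover have coset_eq: "coset f = coset g \<longleftrightarrow> \<chi> f = \<chi> g" for f g
    unfolding coset_eq_iff by (simp add: x_def additive.diff[OF add])
  have "bij_betw h (range coset) UNIV"
  proof (rule bij_betwI')
    show "\<exists>C\<in>range coset. c = h C" for c
      by (rule bexI[of _ "coset (sc c 1)"]) (auto simp: h hom)
  qed (clarsimp simp: h coset_eq)+
  with calculation show pt: "k_rational_point sc x"
    using prime by (auto simp: k_rational_point_def alg_iso_def quot_carrier)
  have v: "value_at sc x (f + g) = value_at sc x f + value_at sc x g" "value_at sc x 1 = 1"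
      "value_at sc x (sc c f) = c * value_at sc x f" for f g c
    using value_at_character(1)[OF pt] by (auto simp: alg_hom_type_alg_iff)
  have "value_at sc x f = \<chi> f" for f
  proof -
    have "\<chi> (f - sc (\<chi> f) 1) = 0"
      by (simp add: additive.diff[OF add] hom)
    then have "value_at sc x (f - sc (\<chi> f) 1) = 0"
      using value_at_character(2)[OF pt] by (simp add: x_def)
    then show ?thesis
      using v(1)[of "f - sc (\<chi> f) 1" "sc (\<chi> f) 1"] by (simp add: v)
  qed
  then show "value_at sc x = \<chi>" by blast
qed

end


section \<open>The tensor product\<close>

lemma free_induct [case_names zero of diff]:
  assumes "P 0" "\<And>b f. P (frag_of (b, f))" "\<And>p q. P p \<Longrightarrow> P q \<Longrightarrow> P (p - q)"
  shows "P p"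
  by (rule frag_induction[of p UNIV]) (use assms in auto)

lemma additive_eqI:
  assumes "additive F" "additive H" "\<And>b f. F (frag_of (b, f)) = H (frag_of (b, f))"
  shows "F p = H p"
  by (induction p rule: free_induct) (simp_all add: additive.zero additive.diff assms)

lemma additive_frag_extend: "additive (frag_extend F)"
  by (rule additiveI) (rule frag_extend_add)

definition free_mult ::
  "('b::{ring, monoid_mult} \<times> 'a::{ring, monoid_mult} \<Rightarrow>\<^sub>0 int) \<Rightarrow> ('b \<times> 'a \<Rightarrow>\<^sub>0 int) \<Rightarrow> ('b \<times> 'a \<Rightarrow>\<^sub>0 int)" where
  "free_mult p q = frag_extend (\<lambda>(b, f). frag_extend (\<lambda>(b', f'). frag_of (b * b', f * f')) q) p"

definition free_scale :: "('k \<Rightarrow> 'b \<Rightarrow> 'b) \<Rightarrow> 'k \<Rightarrow> ('b \<times> 'a \<Rightarrow>\<^sub>0 int) \<Rightarrow> ('b \<times> 'a \<Rightarrow>\<^sub>0 int)" where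
  "free_scale sc c = frag_extend (\<lambda>(b, f). frag_of (sc c b, f))"

definition free_act ::
  "('g \<Rightarrow> 'b \<Rightarrow> 'b) \<Rightarrow> ('g \<Rightarrow> 'a \<Rightarrow> 'a) \<Rightarrow> 'g \<Rightarrow> ('b \<times> 'a \<Rightarrow>\<^sub>0 int) \<Rightarrow> ('b \<times> 'a \<Rightarrow>\<^sub>0 int)" where
  "free_act actB actA g = frag_extend (\<lambda>(b, f). frag_of (actB g b, actA g f))"

lemma free_alg_simps [simp]:
  "carrier (free_alg sc) = UNIV" "p \<otimes>\<^bsub>free_alg sc\<^esub> q = free_mult p q"
  "\<one>\<^bsub>free_alg sc\<^esub> = frag_of (1, 1)" "\<zero>\<^bsub>free_alg sc\<^esub> = 0" "p \<oplus>\<^bsub>free_alg sc\<^esub> q = p + q"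
  "c \<odot>\<^bsub>free_alg sc\<^esub> p = free_scale sc c p"
  by (simp_all add: free_alg_def free_mult_def free_scale_def)

lemma free_mult_of [simp]: "free_mult (frag_of (b, f)) (frag_of (b', f')) = frag_of (b * b', f * f')"
  by (simp add: free_mult_def)

lemma free_scale_of [simp]: "free_scale sc c (frag_of (b, f)) = frag_of (sc c b, f)"
  by (simp add: free_scale_def)

lemma free_act_of [simp]: "free_act actB actA g (frag_of (b, f)) = frag_of (actB g b, actA g f)"
  by (simp add: free_act_def)

lemma additive_free_scale: "additive (free_scale sc c)"
  unfolding free_scale_def by (rule additive_frag_extend)

lemma additive_free_act: "additive (free_act actB actA g)"
  unfolding free_act_def by (rule additive_frag_extend)

lemma additive_free_mult_left: "additive (\<lambda>p. free_mult p q)"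
  unfolding free_mult_def by (rule additive_frag_extend)

lemma additive_free_mult_right: "additive (free_mult p)"
proof (induction p rule: free_induct)
  case zero
  then show ?case
    by (simp add: additiveI additive.zero[OF additive_free_mult_left])
next
  case (of b f)
  then show ?case
    by (simp add: free_mult_def additive_frag_extend)
next
  case (diff p q)
  then show ?case
    by (intro additiveI) (simp add: additive.diff[OF additive_free_mult_left] additive.add)
qed

lemma additive_comp: "additive F \<Longrightarrow> additive H \<Longrightarrow> additive (\<lambda>p. F (H p))"
  by (simp add: additive_def)

lemma free_mult_assoc: "free_mult (free_mult p q) r = free_mult p (free_mult q r)"
proof (rule additive_eqI[of "\<lambda>p. free_mult (free_mult p q) r" "\<lambda>p. free_mult p (free_mult q r)"])
  fix b f
  show "free_mult (free_mult (frag_of (b, f)) q) r = free_mult (frag_of (b, f)) (free_mult q r)"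
  proof (rule additive_eqI[of "\<lambda>q. free_mult (free_mult (frag_of (b, f)) q) r"
        "\<lambda>q. free_mult (frag_of (b, f)) (free_mult q r)"])
    fix b' f'
    show "free_mult (free_mult (frag_of (b, f)) (frag_of (b', f'))) r =
        free_mult (frag_of (b, f)) (free_mult (frag_of (b', f')) r)"
      by (rule additive_eqI[of "free_mult (free_mult (frag_of (b, f)) (frag_of (b', f')))"
            "\<lambda>r. free_mult (frag_of (b, f)) (free_mult (frag_of (b', f')) r)"])
        (auto intro: additive_comp additive_free_mult_left additive_free_mult_right simp: mult.assoc)
  qed (auto intro: additive_comp[OF additive_free_mult_left]
      additive_comp[OF additive_free_mult_right] additive_free_mult_left additive_free_mult_right)
qed (auto intro: additive_comp[OF additive_free_mult_left] additive_free_mult_left)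

lemma free_mult_one: "free_mult (frag_of (1, 1)) p = p" "free_mult p (frag_of (1, 1)) = p"
  by (rule additive_eqI[of _ "\<lambda>p. p"];
      simp add: additive_free_mult_left additive_free_mult_right additive_def[of "\<lambda>p. p"])+

lemma ring_free_alg: "ring (free_alg sc)"
proof (rule ringI)
  show "abelian_group (free_alg sc)"
    by (rule abelian_groupI) (auto simp: algebra_simps intro: exI[of _ "- x" for x] left_minus)
  show "Group.monoid (free_alg sc)"
    by unfold_locales (auto simp: free_mult_assoc free_mult_one)
qed (auto simp: additive.add[OF additive_free_mult_left] additive.add[OF additive_free_mult_right])

locale tensor_product = A: k_algebra scA + B: k_algebra scB
  for scA :: "'k::field \<Rightarrow> 'a::{ring, monoid_mult} \<Rightarrow> 'a"
    and scB :: "'k \<Rightarrow> 'b::{ring, monoid_mult} \<Rightarrow> 'b"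
begin

abbreviation null :: "('b \<times> 'a \<Rightarrow>\<^sub>0 int) set" where
  "null \<equiv> tensor_null scB scA"

lemma subgroup_null: "subgroup null (free_Abelian_group UNIV)"
  unfolding tensor_null_def by (rule group.generate_is_subgroup) auto

lemma null_zero: "0 \<in> null"
  using subgroup.one_closed[OF subgroup_null] by simp

lemma null_add: "p \<in> null \<Longrightarrow> q \<in> null \<Longrightarrow> p + q \<in> null"
  using subgroup.m_closed[OF subgroup_null] by simp

lemma null_minus: "p \<in> null \<Longrightarrow> - p \<in> null"
  using subgroup.m_inv_closed[OF subgroup_null, of p] by simp

lemma null_diff: "p \<in> null \<Longrightarrow> q \<in> null \<Longrightarrow> p - q \<in> null"
  using null_add[OF _ null_minus] by fastforce

lemma null_sum: "(\<And>i. i \<in> I \<Longrightarrow> u i \<in> null) \<Longrightarrow> sum u I \<in> null"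
  by (induction I rule: infinite_finite_induct) (auto simp: null_zero null_add)

lemma null_relators:
  shows null_add_left: "frag_of (b + b', f) - frag_of (b, f) - frag_of (b', f) \<in> null"
    and null_add_right: "frag_of (b, f + f') - frag_of (b, f) - frag_of (b, f') \<in> null"
    and null_balanced: "frag_of (scB c b, f) - frag_of (b, scA c f) \<in> null"
  unfolding tensor_null_def tensor_relators_def by (rule generate.incl; blast)+

text \<open>
  The universal property of the tensor product: to see that an additive map on the free group
  sends the null subgroup into \<open>K\<close>, it suffices to check the three bilinearity relations. With \<open>K = {0}\<close>
  this gives maps out of the tensor product; with \<open>K\<close> the null subgroup, endomorphisms of the
  tensor product.
\<close>

lemma null_induct:
  assumes F: "additive F"
    and K: "0 \<in> K" "\<And>x y. x \<in> K \<Longrightarrow> y \<in> K \<Longrightarrow> x + y \<in> K" "\<And>x. x \<in> K \<Longrightarrow> - x \<in> K"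
    and left: "\<And>b b' f. F (frag_of (b + b', f)) - F (frag_of (b, f)) - F (frag_of (b', f)) \<in> K"
    and right: "\<And>b f f'. F (frag_of (b, f + f')) - F (frag_of (b, f)) - F (frag_of (b, f')) \<in> K"
    and balanced: "\<And>c b f. F (frag_of (scB c b, f)) - F (frag_of (b, scA c f)) \<in> K"
    and p: "p \<in> null"
  shows "F p \<in> K"
proof -
  have rel: "F r \<in> K" if "r \<in> tensor_relators scB scA" for r
    using that left right balanced by (auto simp: tensor_relators_def additive.diff[OF F])
  show ?thesis
    using p unfolding tensor_null_def
  proof (induction rule: generate.induct)
    case one
    then show ?case
      using K(1) by (simp add: additive.zero[OF F])
  next
    case (incl h)
    then show ?case by (rule rel)
  next
    case (inv h)
    then show ?case
      using K(3)[OF rel] by (simp add: additive.minus[OF F])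
  next
    case (eng p q)
    then show ?case
      using K(2) by (simp add: additive.add[OF F])
  qed
qed

lemma null_closed_induct:
  assumes "additive F"
    and "\<And>b b' f. F (frag_of (b + b', f)) - F (frag_of (b, f)) - F (frag_of (b', f)) \<in> null"
    and "\<And>b f f'. F (frag_of (b, f + f')) - F (frag_of (b, f)) - F (frag_of (b, f')) \<in> null"
    and "\<And>c b f. F (frag_of (scB c b, f)) - F (frag_of (b, scA c f)) \<in> null"
    and "p \<in> null"
  shows "F p \<in> null"
  using assms by (intro null_induct[of F null] null_zero null_add null_minus)

lemma null_mult_right: "p \<in> null \<Longrightarrow> free_mult q p \<in> null"
proof (induction q rule: free_induct)
  case zero
  then show ?case
    by (simp add: additive.zero[OF additive_free_mult_left] null_zero)
next
  case (of b f)
  then show ?case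
    by (intro null_closed_induct[OF additive_free_mult_right])
      (simp_all add: distrib_left null_relators A.scale_mult_right B.scale_mult_right)
next
  case (diff p q)
  then show ?case
    by (simp add: additive.diff[OF additive_free_mult_left] null_diff)
qed

lemma null_mult_left: "p \<in> null \<Longrightarrow> free_mult p q \<in> null"
proof (induction q rule: free_induct)
  case zero
  then show ?case
    by (simp add: additive.zero[OF additive_free_mult_right] null_zero)
next
  case (of b f)
  then show ?case
    by (intro null_closed_induct[OF additive_free_mult_left])
      (simp_all add: distrib_right null_relators A.scale_mult_left B.scale_mult_left)
next
  case (diff p q)
  then show ?case
    by (simp add: additive.diff[OF additive_free_mult_right] null_diff)
qed

lemma null_scale: "p \<in> null \<Longrightarrow> free_scale scB c p \<in> null"
proof (erule null_closed_induct[OF additive_free_scale, rotated -1])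
  fix a b f
  show "free_scale scB c (frag_of (scB a b, f)) - free_scale scB c (frag_of (b, scA a f)) \<in> null"
    using null_balanced[of a "scB c b" f] by (simp add: mult.commute)
qed (simp_all add: B.scale_right_distrib null_relators)

lemma ideal_null: "ideal null (free_alg scB)"
proof -
  interpret ring "free_alg scB :: ('k, 'b \<times> 'a \<Rightarrow>\<^sub>0 int) module" by (rule ring_free_alg)
  have inv: "inv\<^bsub>add_monoid (free_alg scB)\<^esub> p = - p" for p :: "'b \<times> 'a \<Rightarrow>\<^sub>0 int"
    using minus_equality[of "- p" p] by (simp add: a_inv_def)
  have "subgroup null (add_monoid (free_alg scB))"
    by (intro group.subgroupI a_group)
      (auto simp: null_add inv[simplified] null_minus intro: null_zero)
  then show ?thesis
    by (intro idealI ring_free_alg) (auto simp: null_mult_left null_mult_right)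
qed

sublocale Q: full_ring_quotient "free_alg scB" null
  by (intro full_ring_quotient.intro full_ring_quotient_axioms.intro ideal_null) (auto intro!: ext)

lemma tensor_carrier: "carrier (tensor_alg scB scA) = range Q.coset"
  unfolding tensor_alg_def by (rule Q.quot_carrier)

lemma tensor_mult: "Q.coset p \<otimes>\<^bsub>tensor_alg scB scA\<^esub> Q.coset q = Q.coset (free_mult p q)"
  unfolding tensor_alg_def using Q.quot_mult[of p q] by simp

lemma tensor_add: "Q.coset p \<oplus>\<^bsub>tensor_alg scB scA\<^esub> Q.coset q = Q.coset (p + q)"
  unfolding tensor_alg_def by (rule Q.quot_add)

lemma tensor_one: "\<one>\<^bsub>tensor_alg scB scA\<^esub> = Q.coset (frag_of (1, 1))"
  unfolding tensor_alg_def using Q.quot_one by simp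

lemma tensor_smult: "c \<odot>\<^bsub>tensor_alg scB scA\<^esub> Q.coset p = Q.coset (free_scale scB c p)"
  unfolding tensor_alg_def using Q.quot_smult[simplified, OF additive_free_scale null_scale] .

text \<open>On the free algebra the scalar \<open>n\<close> acts on the first components of the generators, which differs
  from \<open>n\<close>-fold addition; the two agree modulo the relations.\<close>

lemma free_scale_card:
  assumes "finite I"
  shows "free_scale scB (of_nat (card I)) p - (\<Sum>i\<in>I. p) \<in> null"
proof (induction p rule: free_induct)
  case zero
  then show ?case
    by (simp add: additive.zero[OF additive_free_scale] null_zero)
next
  case (of b f)
  show ?case
    using assms
  proof (induction I rule: finite_induct)
    case empty
    then show ?case
      using null_add_left[of 0 0 f] null_minus by fastforce
  next
    case (insert i I)
    let ?c = "of_nat (card I)"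
    have "frag_of (scB ?c b + b, f) - frag_of (scB ?c b, f) - frag_of (b, f)
        + (free_scale scB ?c (frag_of (b, f)) - (\<Sum>i\<in>I. frag_of (b, f))) \<in> null"
      by (rule null_add[OF null_add_left insert.IH])
    then show ?case
      using insert.hyps by (simp add: B.scale_left_distrib algebra_simps)
  qed
next
  case (diff p q)
  then show ?case
    using null_diff by (fastforce simp: additive.diff[OF additive_free_scale] sum_subtractf algebra_simps)
qed

text \<open>
  Coordinates with respect to a basis of \<open>\<aa>\<close> turn the vanishing of an element of \<open>\<aa> \<otimes> A\<close> at a
  point into the vanishing of finitely many functions there.
\<close>

lemma basis_expansion:
  assumes fd: "finite_dimensional_vector_space scB E"
  shows "\<exists>c. p - (\<Sum>e\<in>E. frag_of (e, c e)) \<in> null"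
proof -
  interpret E: finite_dimensional_vector_space scB E by fact
  have sum_left: "frag_of (sum u I, f) - (\<Sum>i\<in>I. frag_of (u i, f)) \<in> null" if "finite I" for u :: "'b \<Rightarrow> 'b" and I f
    using that
  proof (induction I rule: finite_induct)
    case empty
    show ?case
      using null_add_left[of 0 0 f] null_minus by fastforce
  next
    case (insert i I)
    show ?case
      using null_add[OF null_add_left[of "u i" "sum u I" f] insert.IH] insert.hyps
      by (simp add: algebra_simps)
  qed
  show ?thesis
  proof (induction p rule: free_induct)
    case zero
    have "frag_of (e, 0) \<in> null" for e
      using null_add_right[of e 0 0] null_minus by fastforce
    then show ?case
      by (intro exI[of _ "\<lambda>e. 0"]) (auto intro: null_minus null_sum)
  next
    case (of b f)
    let ?r = "B.representation E b"
    have "(\<Sum>e\<in>E. scB (?r e) e) = b"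
      by (intro B.sum_representation_eq E.independent_Basis)
        (auto simp: E.span_Basis E.finite_Basis)
    then have "frag_of (b, f) - (\<Sum>e\<in>E. frag_of (scB (?r e) e, f)) \<in> null"
      using sum_left[OF E.finite_Basis, of "\<lambda>e. scB (?r e) e" f] by simp
    moreover have "(\<Sum>e\<in>E. frag_of (scB (?r e) e, f) - frag_of (e, scA (?r e) f)) \<in> null"
      by (intro null_sum null_balanced)
    ultimately show ?case
      using null_add by (intro exI[of _ "\<lambda>e. scA (?r e) f"]) (fastforce simp: sum_subtractf)
  next
    case (diff p q)
    then obtain c d where c: "p - (\<Sum>e\<in>E. frag_of (e, c e)) \<in> null"
      and d: "q - (\<Sum>e\<in>E. frag_of (e, d e)) \<in> null" by blast
    have "(\<Sum>e\<in>E. frag_of (e, c e - d e + d e) - frag_of (e, c e - d e) - frag_of (e, d e)) \<in> null"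
      by (intro null_sum null_add_right)
    from null_add[OF null_diff[OF c d] this] show ?case
      by (intro exI[of _ "\<lambda>e. c e - d e"]) (simp add: sum_subtractf sum.distrib algebra_simps)
  qed
qed

end


section \<open>The equivariant map algebra\<close>

text \<open>
  The additive extension of \<open>b \<otimes> f \<mapsto> \<chi>(f) b\<close>, that is, evaluation before the passage to cosets.
  Translating a point by \<open>g\<inverse>\<close> amounts to replacing \<open>\<chi>\<close> by \<open>\<lambda>f. \<chi> (g f)\<close>.
\<close>

definition free_eval ::
  "('k::field \<Rightarrow> 'b \<Rightarrow> 'b) \<Rightarrow> ('a \<Rightarrow> 'k) \<Rightarrow> ('b \<times> 'a \<Rightarrow>\<^sub>0 int) \<Rightarrow> 'b::ab_group_add" where
  "free_eval sc \<chi> p = (\<Sum>(b, f)\<in>Poly_Mapping.keys p.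
      sc (of_int (Poly_Mapping.lookup p (b, f)) * \<chi> f) b)"

locale equivariant_maps =
  A: commutative_algebra_action scA G actA + B: algebra_action scB G actB
  for scA :: "'k::field \<Rightarrow> 'a::{comm_ring, comm_monoid_mult} \<Rightarrow> 'a"
    and scB :: "'k \<Rightarrow> 'b::{ring, monoid_mult} \<Rightarrow> 'b"
    and G :: "('g, 'm) monoid_scheme" (structure)
    and actA :: "'g \<Rightarrow> 'a \<Rightarrow> 'a"
    and actB :: "'g \<Rightarrow> 'b \<Rightarrow> 'b"
begin

sublocale tensor_product scA scB ..

abbreviation "ga \<equiv> free_act actB actA"
abbreviation "\<MM> \<equiv> equivariant_map_alg G scB actB scA actA"

lemma free_act_mult:
  assumes g: "g \<in> carrier G"
  shows "ga g (free_mult p q) = free_mult (ga g p) (ga g q)"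
proof (rule additive_eqI[of "\<lambda>p. ga g (free_mult p q)" "\<lambda>p. free_mult (ga g p) (ga g q)"])
  fix b f
  show "ga g (free_mult (frag_of (b, f)) q) = free_mult (ga g (frag_of (b, f))) (ga g q)"
    by (rule additive_eqI[of "\<lambda>q. ga g (free_mult (frag_of (b, f)) q)"
          "\<lambda>q. free_mult (ga g (frag_of (b, f))) (ga g q)"])
      (auto intro!: additive_comp[OF additive_free_act additive_free_mult_right]
        additive_comp[OF additive_free_mult_right additive_free_act]
        simp: A.act_mult[OF g] B.act_mult[OF g])
qed (rule additive_comp[OF additive_free_act additive_free_mult_left]
    additive_comp[OF additive_free_mult_left additive_free_act])+

lemma free_act_comp:
  assumes "g \<in> carrier G" "h \<in> carrier G"
  shows "ga (g \<otimes> h) p = ga g (ga h p)"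
  by (rule additive_eqI[of _ "\<lambda>p. ga g (ga h p)"])
    (auto intro: additive_comp additive_free_act simp: A.act_comp B.act_comp assms)

lemma null_act:
  assumes g: "g \<in> carrier G" and p: "p \<in> null"
  shows "ga g p \<in> null"
  using p by (intro null_closed_induct[OF additive_free_act])
    (simp_all add: A.act_add[OF g] B.act_add[OF g] A.act_scale[OF g] B.act_scale[OF g] null_relators)

lemma tensor_action_coset:
  "g \<in> carrier G \<Longrightarrow> tensor_action scB scA actB actA g (Q.coset p) = Q.coset (ga g p)"
  using Q.Union_coset_image[OF additive_free_act null_act] by (simp add: tensor_action_def free_act_def)

text \<open>The representatives of the elements of the equivariant map algebra; only their cosets are fixed.\<close>

definition invariant :: "('b \<times> 'a \<Rightarrow>\<^sub>0 int) set" where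
  "invariant = {p. \<forall>g\<in>carrier G. ga g p - p \<in> null}"

lemma carrier_equivariant: "carrier \<MM> = Q.coset ` invariant"
proof -
  have "carrier \<MM> = {C \<in> range Q.coset. \<forall>g\<in>carrier G. tensor_action scB scA actB actA g C = C}"
    by (simp add: equivariant_map_alg_def fixed_alg_def tensor_carrier)
  also have "\<dots> = Q.coset ` {p. \<forall>g\<in>carrier G. tensor_action scB scA actB actA g (Q.coset p) = Q.coset p}"
    by blast
  also have "\<dots> = Q.coset ` invariant"
    by (simp add: invariant_def tensor_action_coset Q.coset_eq_iff)
  finally show ?thesis .
qed

lemma equivariant_ops:
  "Q.coset p \<otimes>\<^bsub>\<MM>\<^esub> Q.coset q = Q.coset (free_mult p q)"
  "Q.coset p \<oplus>\<^bsub>\<MM>\<^esub> Q.coset q = Q.coset (p + q)"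
  "\<one>\<^bsub>\<MM>\<^esub> = Q.coset (frag_of (1, 1))"
  "c \<odot>\<^bsub>\<MM>\<^esub> Q.coset p = Q.coset (free_scale scB c p)"
  by (simp_all add: equivariant_map_alg_def fixed_alg_def tensor_mult tensor_add tensor_one tensor_smult)

definition free_trace :: "('b \<times> 'a \<Rightarrow>\<^sub>0 int) \<Rightarrow> ('b \<times> 'a \<Rightarrow>\<^sub>0 int)" where
  "free_trace p = (\<Sum>g\<in>carrier G. ga g p)"

lemma additive_free_trace: "additive free_trace"
  by (rule additiveI) (simp add: free_trace_def additive.add[OF additive_free_act] sum.distrib)

lemma null_trace: "p \<in> null \<Longrightarrow> free_trace p \<in> null"
  unfolding free_trace_def by (intro null_sum null_act)

lemma free_act_trace: "h \<in> carrier G \<Longrightarrow> ga h (free_trace p) = free_trace p"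
  unfolding free_trace_def
  using A.sum_group_shift[of h "\<lambda>g. ga g p"]
  by (simp add: additive.sum[OF additive_free_act] free_act_comp)

lemma free_trace_act:
  assumes h: "h \<in> carrier G"
  shows "free_trace (ga h p) = free_trace p"
  unfolding free_trace_def
  by (rule sum.reindex_bij_witness[of _ "\<lambda>g. g \<otimes> inv h" "\<lambda>g. g \<otimes> h"])
    (use h in \<open>auto simp: A.m_assoc free_act_comp\<close>)

lemma trace_invariant: "free_trace p \<in> invariant"
  by (simp add: invariant_def free_act_trace null_zero)

text \<open>Since the second trace is fixed by each \<open>g\<close>, it can be moved inside \<open>ga g\<close> in the first one.\<close>

lemma trace_mult_trace:
  "free_mult (free_trace p) (free_trace q) = (\<Sum>h\<in>carrier G. free_trace (free_mult p (ga h q)))"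
proof -
  have "free_mult (free_trace p) (free_trace q) = (\<Sum>g\<in>carrier G. free_mult (ga g p) (free_trace q))"
    unfolding free_trace_def[of p] by (rule additive.sum[OF additive_free_mult_left])
  also have "\<dots> = (\<Sum>g\<in>carrier G. ga g (free_mult p (free_trace q)))"
    by (rule sum.cong) (simp_all add: free_act_mult free_act_trace)
  also have "\<dots> = free_trace (free_mult p (free_trace q))"
    by (simp add: free_trace_def)
  also have "\<dots> = (\<Sum>h\<in>carrier G. free_trace (free_mult p (ga h q)))"
    unfolding free_trace_def[of q]
    by (simp add: additive.sum[OF additive_free_mult_right] additive.sum[OF additive_free_trace])
  finally show ?thesis .
qed

lemma trace_invariant_multiple:
  assumes "p \<in> invariant"
  shows "free_trace p - free_scale scB (of_nat (Coset.order G)) p \<in> null"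
proof -
  have "(\<Sum>g\<in>carrier G. ga g p - p) \<in> null"
    using assms by (intro null_sum) (simp add: invariant_def)
  then have "free_trace p - (\<Sum>g\<in>carrier G. p) \<in> null"
    by (simp add: free_trace_def sum_subtractf)
  from null_diff[OF this free_scale_card[OF A.finite_group, of p]] show ?thesis
    by (simp add: Coset.order_def)
qed

lemma
  shows invariant_add: "p \<in> invariant \<Longrightarrow> q \<in> invariant \<Longrightarrow> p + q \<in> invariant"
    and invariant_mult: "p \<in> invariant \<Longrightarrow> q \<in> invariant \<Longrightarrow> free_mult p q \<in> invariant"
    and invariant_one: "frag_of (1, 1) \<in> invariant"
    and invariant_scale: "p \<in> invariant \<Longrightarrow> free_scale scB c p \<in> invariant"
proof -
  show "p + q \<in> invariant" if p: "p \<in> invariant" and q: "q \<in> invariant"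
  proof -
    have "(ga g p - p) + (ga g q - q) \<in> null" if "g \<in> carrier G" for g
      using p q that by (intro null_add) (auto simp: invariant_def)
    then show ?thesis
      by (simp add: invariant_def additive.add[OF additive_free_act] algebra_simps)
  qed
  show "free_mult p q \<in> invariant" if p: "p \<in> invariant" and q: "q \<in> invariant"
  proof -
    have "ga g (free_mult p q) - free_mult p q \<in> null" if g: "g \<in> carrier G" for g
    proof -
      have "free_mult (ga g p - p) (ga g q) + free_mult p (ga g q - q) \<in> null"
        using p q g by (intro null_add null_mult_left null_mult_right) (auto simp: invariant_def)
      then show ?thesis
        by (simp add: free_act_mult[OF g] additive.diff[OF additive_free_mult_left]
            additive.diff[OF additive_free_mult_right])
    qed
    then show ?thesis
      by (simp add: invariant_def)
  qed
  show "frag_of (1, 1) \<in> invariant"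
    by (simp add: invariant_def A.act_one B.act_one null_zero)
  show "free_scale scB c p \<in> invariant" if p: "p \<in> invariant"
  proof -
    have "ga g (free_scale scB c p) - free_scale scB c p \<in> null" if g: "g \<in> carrier G" for g
    proof -
      have "ga g (free_scale scB c p) = free_scale scB c (ga g p)"
        by (rule additive_eqI[of "\<lambda>p. ga g (free_scale scB c p)" "\<lambda>p. free_scale scB c (ga g p)"])
          (auto intro: additive_comp additive_free_act additive_free_scale simp: B.act_scale[OF g])
      then show ?thesis
        using null_scale[of "ga g p - p" c] p g
        by (simp add: invariant_def additive.diff[OF additive_free_scale])
    qed
    then show ?thesis
      by (simp add: invariant_def)
  qed
qed


subsection \<open>Evaluation\<close>

lemma free_eval_superset:
  fixes \<chi> :: "'a \<Rightarrow> 'k"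
  assumes "finite K" "Poly_Mapping.keys p \<subseteq> K"
  shows "free_eval scB \<chi> p = (\<Sum>(b, f)\<in>K. scB (of_int (Poly_Mapping.lookup p (b, f)) * \<chi> f) b)"
  unfolding free_eval_def
  by (rule sum.mono_neutral_left) (use assms in \<open>auto simp: in_keys_iff\<close>)

lemma additive_free_eval:
  fixes \<chi> :: "'a \<Rightarrow> 'k"
  shows "additive (free_eval scB \<chi>)"
proof (rule additiveI)
  fix p q :: "'b \<times> 'a \<Rightarrow>\<^sub>0 int"
  let ?K = "Poly_Mapping.keys p \<union> Poly_Mapping.keys q"
  have "Poly_Mapping.keys (p + q) \<subseteq> ?K"
    by (rule Poly_Mapping.keys_add)
  then show "free_eval scB \<chi> (p + q) = free_eval scB \<chi> p + free_eval scB \<chi> q"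
    by (simp add: free_eval_superset[of ?K] lookup_add distrib_right B.scale_left_distrib
        sum.distrib case_prod_beta)
qed

lemma free_eval_of [simp]: "free_eval scB \<chi> (frag_of (b, f)) = scB (\<chi> f) b"
  by (simp add: free_eval_def)

context
  fixes \<chi> :: "'a \<Rightarrow> 'k"
  assumes \<chi>: "\<chi> \<in> alg_hom (type_alg scA) (type_alg (*))"
begin

lemma character_simps:
  "\<chi> (f + g) = \<chi> f + \<chi> g" "\<chi> (f * g) = \<chi> f * \<chi> g" "\<chi> 1 = 1" "\<chi> (scA c f) = c * \<chi> f"
  using \<chi> by (auto simp: alg_hom_type_alg_iff)

lemma free_eval_null: "p \<in> null \<Longrightarrow> free_eval scB \<chi> p = 0"
  using null_induct[OF additive_free_eval, of "{0}" \<chi> p]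
  by (simp add: character_simps B.scale_left_distrib B.scale_right_distrib mult.commute)

lemma free_eval_mult: "free_eval scB \<chi> (free_mult p q) = free_eval scB \<chi> p * free_eval scB \<chi> q"
proof (rule additive_eqI[of "\<lambda>p. free_eval scB \<chi> (free_mult p q)"
      "\<lambda>p. free_eval scB \<chi> p * free_eval scB \<chi> q"])
  fix b f
  show "free_eval scB \<chi> (free_mult (frag_of (b, f)) q) = free_eval scB \<chi> (frag_of (b, f)) * free_eval scB \<chi> q"
    by (rule additive_eqI[of "\<lambda>q. free_eval scB \<chi> (free_mult (frag_of (b, f)) q)"
          "\<lambda>q. free_eval scB \<chi> (frag_of (b, f)) * free_eval scB \<chi> q"])
      (auto intro: additive_comp[OF additive_free_eval additive_free_mult_right] additiveI
        simp: additive.add[OF additive_free_eval] distrib_left character_simps B.scale_mult_left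
          B.scale_mult_right B.scale_right_distrib)
qed (auto intro: additive_comp[OF additive_free_eval additive_free_mult_left] additiveI
    simp: additive.add[OF additive_free_eval] distrib_right)

lemma free_eval_scale: "free_eval scB \<chi> (free_scale scB c p) = scB c (free_eval scB \<chi> p)"
  by (rule additive_eqI[of "\<lambda>p. free_eval scB \<chi> (free_scale scB c p)" "\<lambda>p. scB c (free_eval scB \<chi> p)"])
    (auto intro: additive_comp[OF additive_free_eval additive_free_scale] additiveI
      simp: additive.add[OF additive_free_eval] B.scale_right_distrib mult.commute)

end

lemma evaluation_coset:
  assumes "k_rational_point scA x"
  shows "evaluation scB scA x (Q.coset p) = free_eval scB (value_at scA x) p"
  using Q.the_elem_coset_image[OF additive_free_eval free_eval_null,
      OF value_at_character(1)[OF A.k_algebra_axioms assms], of p]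
  by (simp add: evaluation_def free_eval_def[abs_def])

lemma free_eval_act:
  assumes g: "g \<in> carrier G"
  shows "free_eval scB (\<lambda>f. \<chi> (actA g f)) p = actB (inv g) (free_eval scB \<chi> (ga g p))"
proof (rule additive_eqI[of "free_eval scB (\<lambda>f. \<chi> (actA g f))"])
  show "additive (\<lambda>p. actB (inv g) (free_eval scB \<chi> (ga g p)))"
    using g by (intro additiveI)
      (simp add: additive.add[OF additive_free_act] additive.add[OF additive_free_eval] B.act_add)
qed (use g in \<open>simp_all add: additive_free_eval B.act_scale B.act_inv\<close>)

context
  fixes x
  assumes x: "k_rational_point scA x"
begin

lemma value_at_simps:
  "value_at scA x (f + f') = value_at scA x f + value_at scA x f'"
  "value_at scA x (f * f') = value_at scA x f * value_at scA x f'"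
  "value_at scA x 1 = 1" "value_at scA x (scA c f) = c * value_at scA x f"
  using value_at_character(1)[OF A.k_algebra_axioms x] by (auto simp: alg_hom_type_alg_iff)

lemma value_at_diff: "value_at scA x (f - f') = value_at scA x f - value_at scA x f'"
  by (rule additive.diff[OF additiveI]) (rule value_at_simps)

lemma mem_point_iff: "f \<in> x \<longleftrightarrow> value_at scA x f = 0"
  using value_at_character(2)[OF A.k_algebra_axioms x] by simp

abbreviation "\<Gamma>x \<equiv> point_stabilizer G actA x"

text \<open>
  Two points coincide iff the values of all functions at them do: given equal ideals, compare the
  values of \<open>f - f(x)\<close>.
\<close>

lemma stabilizer_iff:
  "g \<in> \<Gamma>x \<longleftrightarrow> g \<in> carrier G \<and> (\<forall>f. value_at scA x (actA (inv g) f) = value_at scA x f)"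
proof (cases "g \<in> carrier G")
  case g: True
  have "actA g ` x = {f. actA (inv g) f \<in> x}"
    using g by (force simp: A.act_inv A.act_inv' intro: image_eqI[of _ _ "actA (inv g) f" for f])
  moreover have "value_at scA x (actA (inv g) f) = value_at scA x f"
    if "\<And>f. value_at scA x (actA (inv g) f) = 0 \<longleftrightarrow> value_at scA x f = 0" for f
    using that[of "f - scA (value_at scA x f) 1"] g
    by (simp add: value_at_diff value_at_simps A.act_diff A.act_scale A.act_one)
  ultimately show ?thesis
    using g by (auto simp: point_stabilizer_def stabilizer_def set_eq_iff mem_point_iff)
next
  case False
  then show ?thesis
    by (simp add: point_stabilizer_def stabilizer_def)
qed

lemma isotropy_carrier: "carrier (isotropy_alg G scB actB actA x) = {b. \<forall>g\<in>\<Gamma>x. actB g b = b}"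
  by (simp add: isotropy_alg_def fixed_alg_def)

lemma free_eval_invariant:
  assumes p: "p \<in> invariant" and g: "g \<in> carrier G"
  shows "free_eval scB (\<lambda>f. value_at scA x (actA g f)) p = actB (inv g) (free_eval scB (value_at scA x) p)"
proof -
  have "free_eval scB (value_at scA x) (ga g p - p) = 0"
    using p g by (intro free_eval_null value_at_character(1)[OF A.k_algebra_axioms x])
      (simp add: invariant_def)
  then show ?thesis
    by (simp add: free_eval_act[OF g] additive.diff[OF additive_free_eval])
qed

lemma evaluation_in_isotropy:
  assumes "p \<in> invariant"
  shows "free_eval scB (value_at scA x) p \<in> carrier (isotropy_alg G scB actB actA x)"
proof -
  have "actB g (free_eval scB (value_at scA x) p) = free_eval scB (value_at scA x) p" if "g \<in> \<Gamma>x" for g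
  proof -
    have g: "g \<in> carrier G" "(\<lambda>f. value_at scA x (actA (inv g) f)) = value_at scA x"
      using that by (auto simp: stabilizer_iff)
    then show ?thesis
      using free_eval_invariant[OF assms, of "inv g"] by simp
  qed
  then show ?thesis
    by (simp add: isotropy_carrier)
qed

text \<open>
  For each translate of \<open>x\<close> other than \<open>x\<close> itself there is a function with value \<open>1\<close> at \<open>x\<close> and value
  \<open>0\<close> at the translate. The product of these functions is \<open>1\<close> at \<open>x\<close> and \<open>0\<close> on the rest of the orbit.
\<close>

lemma separating_function:
  "\<exists>f. \<forall>g\<in>carrier G. value_at scA x (actA (inv g) f) = (if g \<in> \<Gamma>x then 1 else 0)"
proof -
  let ?v = "value_at scA x"
  have "\<exists>f. ?v f = 1 \<and> ?v (actA (inv g) f) = 0" if g: "g \<in> carrier G - \<Gamma>x" for g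
  proof -
    obtain f where f: "?v (actA (inv g) f) \<noteq> ?v f"
      using g by (auto simp: stabilizer_iff)
    let ?a = "?v (actA (inv g) f)"
    let ?f = "scA (inverse (?v f - ?a)) (f - scA ?a 1)"
    have "?v ?f = 1" "?v (actA (inv g) ?f) = 0"
      using f g by (simp_all add: value_at_diff value_at_simps A.act_diff A.act_scale A.act_one)
    then show ?thesis by blast
  qed
  then obtain u where u: "\<And>g. g \<in> carrier G - \<Gamma>x \<Longrightarrow> ?v (u g) = 1 \<and> ?v (actA (inv g) (u g)) = 0"
    by metis
  let ?f = "\<Prod>g\<in>carrier G - \<Gamma>x. u g"
  have v_prod: "?v (prod w I) = (\<Prod>i\<in>I. ?v (w i))" for w :: "'g \<Rightarrow> 'a" and I
    by (induction I rule: infinite_finite_induct) (simp_all add: value_at_simps)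
  have "?v (actA (inv g) ?f) = (if g \<in> \<Gamma>x then 1 else 0)" if g: "g \<in> carrier G" for g
  proof (cases "g \<in> \<Gamma>x")
    case True
    then have "?v (actA (inv g) ?f) = ?v ?f"
      by (simp add: stabilizer_iff)
    then show ?thesis
      using True u by (simp add: v_prod)
  next
    case False
    have "?v (actA (inv g) ?f) = (\<Prod>h\<in>carrier G - \<Gamma>x. ?v (actA (inv g) (u h)))"
      using g by (simp add: A.act_prod v_prod)
    also have "\<dots> = 0"
      using False g u[of g] A.finite_group by (intro prod_zero) auto
    finally show ?thesis
      using False by simp
  qed
  then show ?thesis by blast
qed

text \<open>
  If \<open>f\<close> is \<open>1\<close> at \<open>x\<close> and \<open>0\<close> on the rest of the orbit, then at \<open>x\<close> only the summands with \<open>g\<close> in the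
  stabilizer contribute to \<open>\<Sum>g. g \<cdot> (b \<otimes> f)\<close>, and each of them contributes \<open>b\<close>. The number of these
  summands divides the order of the group, so it is invertible in \<open>k\<close>.
\<close>

lemma evaluation_surjective:
  assumes order: "of_nat (Coset.order G) \<noteq> (0::'k)"
    and b: "b \<in> carrier (isotropy_alg G scB actB actA x)"
  shows "\<exists>p\<in>invariant. free_eval scB (value_at scA x) p = b"
proof -
  let ?v = "value_at scA x"
  have sub: "\<Gamma>x \<subseteq> carrier G"
    by (auto simp: stabilizer_iff)
  have one: "\<one> \<in> \<Gamma>x"
    by (simp add: stabilizer_iff A.act_id)
  have "subgroup \<Gamma>x G"
  proof (rule A.subgroupI[OF sub])
    show "\<Gamma>x \<noteq> {}" using one by blast
    show "inv g \<in> \<Gamma>x" if "g \<in> \<Gamma>x" for g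
      using that A.act_inv[of g] unfolding stabilizer_iff by (metis A.inv_closed A.inv_inv)
    show "g \<otimes> h \<in> \<Gamma>x" if "g \<in> \<Gamma>x" "h \<in> \<Gamma>x" for g h
      using that by (simp add: stabilizer_iff A.inv_mult_group A.act_comp)
  qed
  then have "card \<Gamma>x dvd Coset.order G"
    using A.lagrange[of \<Gamma>x] by (metis dvd_triv_right)
  then have card: "of_nat (card \<Gamma>x) \<noteq> (0::'k)"
    using order by (auto elim!: dvdE)
  obtain f where f: "\<And>g. g \<in> carrier G \<Longrightarrow> ?v (actA (inv g) f) = (if g \<in> \<Gamma>x then 1 else 0)"
    using separating_function by blast
  let ?p = "free_trace (frag_of (b, f))"
  have "free_eval scB ?v ?p = (\<Sum>g\<in>carrier G. scB (?v (actA g f)) (actB g b))"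
    by (simp add: free_trace_def additive.sum[OF additive_free_eval])
  also have "\<dots> = (\<Sum>g\<in>\<Gamma>x. scB (?v (actA g f)) (actB g b))"
  proof (rule sum.mono_neutral_right[OF A.finite_group sub])
    have "inv g \<notin> \<Gamma>x" if "g \<in> carrier G - \<Gamma>x" for g
      using that subgroup.m_inv_closed[OF \<open>subgroup \<Gamma>x G\<close>, of "inv g"] by auto
    moreover have "?v (actA g f) = (if inv g \<in> \<Gamma>x then 1 else 0)" if "g \<in> carrier G" for g
      using f[of "inv g"] that by simp
    ultimately show "\<forall>g\<in>carrier G - \<Gamma>x. scB (?v (actA g f)) (actB g b) = 0"
      by simp
  qed
  also have "\<dots> = (\<Sum>g\<in>\<Gamma>x. b)"
  proof (rule sum.cong)
    fix g assume g: "g \<in> \<Gamma>x"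
    then have "inv g \<in> \<Gamma>x" "inv g \<in> carrier G" "g \<in> carrier G"
      using subgroup.m_inv_closed[OF \<open>subgroup \<Gamma>x G\<close>] sub by auto
    then show "scB (?v (actA g f)) (actB g b) = b"
      using f[of "inv g"] b g by (simp add: isotropy_carrier)
  qed simp
  also have "\<dots> = scB (of_nat (card \<Gamma>x)) b"
    by (rule B.sum_constant_scale)
  finally have "free_eval scB ?v (free_scale scB (inverse (of_nat (card \<Gamma>x))) ?p) = b"
    using card by (simp add: free_eval_scale[OF value_at_character(1)[OF A.k_algebra_axioms x]])
  then show ?thesis
    using invariant_scale[OF trace_invariant] by blast
qed

end

end


section \<open>Irreducible representations\<close>

lemma End_alg_simps [simp]:
  "carrier (End_alg sc) = {T. Vector_Spaces.linear sc sc T}" "S \<otimes>\<^bsub>End_alg sc\<^esub> T = S \<circ> T"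
  "\<one>\<^bsub>End_alg sc\<^esub> = id" "S \<oplus>\<^bsub>End_alg sc\<^esub> T = (\<lambda>v. S v + T v)"
  "c \<odot>\<^bsub>End_alg sc\<^esub> T = (\<lambda>v. sc c (T v))"
  by (simp_all add: End_alg_def)

lemma isotropy_alg_simps [simp]:
  "b \<otimes>\<^bsub>isotropy_alg G sc actB actA x\<^esub> b' = b * b'" "\<one>\<^bsub>isotropy_alg G sc actB actA x\<^esub> = 1"
  "b \<oplus>\<^bsub>isotropy_alg G sc actB actA x\<^esub> b' = b + b'" "c \<odot>\<^bsub>isotropy_alg G sc actB actA x\<^esub> b = sc c b"
  by (simp_all add: isotropy_alg_def fixed_alg_def)

text \<open>
  Irreducibility depends on the set of operators only. This transfers it along the surjection \<open>ev\<^sub>x\<close> in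
  both directions.
\<close>

lemma irreducible_representation_image:
  fixes sc :: "'k::field \<Rightarrow> 'v::ab_group_add \<Rightarrow> 'v"
  assumes B: "irreducible_representation B sc \<rho>" and C: "representation C sc \<sigma>"
    and eq: "\<rho> ` carrier B = \<sigma> ` carrier C"
  shows "irreducible_representation C sc \<sigma>"
  unfolding irreducible_representation_def
proof (intro conjI allI impI)
  show "representation C sc \<sigma>" by (rule C)
  show "(UNIV :: 'v set) \<noteq> {0}"
    using B by (simp add: irreducible_representation_def)
  fix W assume W: "Modules.module.subspace sc W \<and> (\<forall>c\<in>carrier C. \<sigma> c ` W \<subseteq> W)"
  have "\<rho> b ` W \<subseteq> W" if "b \<in> carrier B" for b
  proof -
    have "\<rho> b \<in> \<sigma> ` carrier C"
      unfolding eq[symmetric] using that by (rule imageI)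
    then obtain c where "\<rho> b = \<sigma> c" "c \<in> carrier C"
      by (rule imageE)
    then show ?thesis using W by simp
  qed
  then show "W = {0} \<or> W = UNIV"
    using B W by (simp add: irreducible_representation_def)
qed

context equivariant_maps
begin

lemma isotropy_subspace: "B.subspace (carrier (isotropy_alg G scB actB actA x))"
proof -
  have "point_stabilizer G actA x \<subseteq> carrier G"
    by (auto simp: point_stabilizer_def stabilizer_def)
  then show ?thesis
    by (intro B.subspaceI) (auto simp: isotropy_alg_def fixed_alg_def B.act_zero B.act_add B.act_scale subset_iff)
qed

lemma isotropy_finite_span:
  assumes "finite_dimensional_vector_space scB E"
  shows "\<exists>S. finite S \<and> B.span S = carrier (isotropy_alg G scB actB actA x)"
proof -
  interpret E: finite_dimensional_vector_space scB E by fact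
  let ?C = "carrier (isotropy_alg G scB actB actA x)"
  obtain S where S: "S \<subseteq> ?C" "B.independent S" "?C \<subseteq> B.span S"
    by (rule B.basis_exists[of ?C])
  have "B.span S = ?C"
    by (rule B.span_subspace[OF S(1,3) isotropy_subspace])
  then show ?thesis
    using E.finiteI_independent[OF S(2)] by (intro exI[of _ S] conjI)
qed

context
  fixes x
  assumes x: "k_rational_point scA x"
begin

lemma evaluation_image:
  assumes "of_nat (Coset.order G) \<noteq> (0::'k)"
  shows "evaluation scB scA x ` carrier \<MM> = carrier (isotropy_alg G scB actB actA x)"
  using evaluation_surjective[OF x assms] evaluation_in_isotropy[OF x]
  by (force simp: carrier_equivariant image_image evaluation_coset[OF x])

lemma evaluation_representation:
  assumes \<rho>x: "representation (isotropy_alg G scB actB actA x) scV \<rho>x"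
  shows "representation \<MM> scV (\<rho>x \<circ> evaluation scB scA x)"
proof -
  let ?v = "value_at scA x"
  have \<chi>: "?v \<in> alg_hom (type_alg scA) (type_alg (*))"
    by (rule value_at_character(1)[OF A.k_algebra_axioms x])
  note ev = evaluation_in_isotropy[OF x]
  let ?I = "isotropy_alg G scB actB actA x"
  have hom: "\<rho>x \<in> ring_hom ?I (End_alg scV)"
    and scale: "\<And>c b. b \<in> carrier ?I \<Longrightarrow> \<rho>x (scB c b) = (\<lambda>v. scV c (\<rho>x b v))"
    using \<rho>x by (auto simp: representation_def alg_hom_def)
  let ?r = "\<rho>x \<circ> evaluation scB scA x"
  have r: "?r (Q.coset p) = \<rho>x (free_eval scB ?v p)" for p
    by (simp add: evaluation_coset[OF x])
  have "?r \<in> ring_hom \<MM> (End_alg scV)"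
  proof (rule ring_hom_memI)
    fix \<alpha> assume "\<alpha> \<in> carrier \<MM>"
    then obtain p where p: "\<alpha> = Q.coset p" "p \<in> invariant"
      unfolding carrier_equivariant by blast
    show "?r \<alpha> \<in> carrier (End_alg scV)"
      unfolding p r by (rule ring_hom_closed[OF hom ev[OF p(2)]])
    fix \<beta> assume "\<beta> \<in> carrier \<MM>"
    then obtain q where q: "\<beta> = Q.coset q" "q \<in> invariant"
      unfolding carrier_equivariant by blast
    show "?r (\<alpha> \<otimes>\<^bsub>\<MM>\<^esub> \<beta>) = ?r \<alpha> \<otimes>\<^bsub>End_alg scV\<^esub> ?r \<beta>"
      unfolding p q r equivariant_ops free_eval_mult[OF \<chi>]
      using ring_hom_mult[OF hom ev[OF p(2)] ev[OF q(2)]] by simp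
    show "?r (\<alpha> \<oplus>\<^bsub>\<MM>\<^esub> \<beta>) = ?r \<alpha> \<oplus>\<^bsub>End_alg scV\<^esub> ?r \<beta>"
      unfolding p q r equivariant_ops additive.add[OF additive_free_eval]
      using ring_hom_add[OF hom ev[OF p(2)] ev[OF q(2)]] by simp
  next
    show "?r \<one>\<^bsub>\<MM>\<^esub> = \<one>\<^bsub>End_alg scV\<^esub>"
      unfolding equivariant_ops r using ring_hom_one[OF hom] by (simp add: character_simps[OF \<chi>])
  qed
  moreover have "?r (c \<odot>\<^bsub>\<MM>\<^esub> \<alpha>) = c \<odot>\<^bsub>End_alg scV\<^esub> ?r \<alpha>" if \<alpha>: "\<alpha> \<in> carrier \<MM>" for c \<alpha>
  proof -
    obtain p where p: "\<alpha> = Q.coset p" "p \<in> invariant"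
      using \<alpha> unfolding carrier_equivariant by blast
    show ?thesis
      unfolding p r equivariant_ops free_eval_scale[OF \<chi>] using scale[OF ev[OF p(2)]] by simp
  qed
  ultimately show ?thesis
    using \<rho>x by (simp add: representation_def alg_hom_def)
qed

end

end

locale irreducible_equivariant_representation =
  equivariant_maps scA scB G actA actB + B: finite_dimensional_vector_space scB E +
  V: finite_dimensional_vector_space scV F
  for scA :: "'k::alg_closed_field \<Rightarrow> 'a::{comm_ring, comm_monoid_mult} \<Rightarrow> 'a"
    and scB :: "'k \<Rightarrow> 'b::{ring, monoid_mult} \<Rightarrow> 'b"
    and G :: "('g, 'm) monoid_scheme" (structure)
    and actA :: "'g \<Rightarrow> 'a \<Rightarrow> 'a"
    and actB :: "'g \<Rightarrow> 'b \<Rightarrow> 'b"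
    and E
    and scV :: "'k \<Rightarrow> 'v::ab_group_add \<Rightarrow> 'v"
    and F
    and \<rho> :: "('b \<times> 'a \<Rightarrow>\<^sub>0 int) set \<Rightarrow> 'v \<Rightarrow> 'v" +
  assumes order_nonzero: "of_nat (Coset.order G) \<noteq> (0::'k)"
    and irreducible: "irreducible_representation \<MM> scV \<rho>"
begin

definition rep :: "('b \<times> 'a \<Rightarrow>\<^sub>0 int) \<Rightarrow> 'v \<Rightarrow> 'v" where
  "rep p = \<rho> (Q.coset p)"

lemma rep_hom: "\<rho> \<in> alg_hom \<MM> (End_alg scV)"
  using irreducible by (simp add: irreducible_representation_def representation_def)

lemma
  assumes p: "p \<in> invariant"
  shows rep_linear: "Vector_Spaces.linear scV scV (rep p)"
    and rep_add: "q \<in> invariant \<Longrightarrow> rep (p + q) = (\<lambda>v. rep p v + rep q v)"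
    and rep_mult: "q \<in> invariant \<Longrightarrow> rep (free_mult p q) = rep p \<circ> rep q"
    and rep_scale: "rep (free_scale scB c p) = (\<lambda>v. scV c (rep p v))"
proof -
  have C: "Q.coset r \<in> carrier \<MM>" if "r \<in> invariant" for r
    using that by (simp add: carrier_equivariant)
  have hom: "\<rho> \<in> ring_hom \<MM> (End_alg scV)"
    using rep_hom by (simp add: alg_hom_def)
  show "Vector_Spaces.linear scV scV (rep p)"
    using ring_hom_closed[OF hom C[OF p]] by (simp add: rep_def)
  show "rep (p + q) = (\<lambda>v. rep p v + rep q v)" if "q \<in> invariant"
    using ring_hom_add[OF hom C[OF p] C[OF that]] by (simp add: rep_def equivariant_ops)
  show "rep (free_mult p q) = rep p \<circ> rep q" if "q \<in> invariant"
    using ring_hom_mult[OF hom C[OF p] C[OF that]] by (simp add: rep_def equivariant_ops)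
  show "rep (free_scale scB c p) = (\<lambda>v. scV c (rep p v))"
  proof -
    have "\<rho> (c \<odot>\<^bsub>\<MM>\<^esub> Q.coset p) = c \<odot>\<^bsub>End_alg scV\<^esub> \<rho> (Q.coset p)"
      using rep_hom C[OF p] by (simp add: alg_hom_def)
    then show ?thesis
      by (simp add: equivariant_ops rep_def)
  qed
qed

lemma rep_one: "rep (frag_of (1, 1)) = id"
  using rep_hom ring_hom_one[of \<rho> \<MM> "End_alg scV"]
  by (simp add: rep_def equivariant_ops alg_hom_def)

lemma rep_cong: "p - q \<in> null \<Longrightarrow> rep p = rep q"
  unfolding rep_def by (simp add: Q.coset_eqI)

lemma additive_rep_trace: "additive (\<lambda>p. rep (free_trace p) v)"
  by (rule additiveI) (simp add: additive.add[OF additive_free_trace] rep_add trace_invariant)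

lemma rep_trace_invariant:
  assumes "p \<in> invariant"
  shows "rep (free_trace p) v = scV (of_nat (Coset.order G)) (rep p v)"
  using rep_cong[OF trace_invariant_multiple[OF assms]] by (simp add: rep_scale[OF assms])

definition trace_operator :: "'b \<Rightarrow> 'a \<Rightarrow> 'v \<Rightarrow> 'v" where
  "trace_operator b f = rep (free_trace (frag_of (b, f)))"

lemma rep_trace_cong:
  assumes "p - q \<in> null"
  shows "rep (free_trace p) = rep (free_trace q)"
  using null_trace[OF assms] by (intro rep_cong) (simp add: additive.diff[OF additive_free_trace])

text \<open>
  A subspace that is stable under the traces is stable under \<open>\<rho>\<close>: an invariant element is its own
  trace divided by the order of the group.
\<close>

lemma irreducible_operators_trace:
  "irreducible_operators scV F (range (\<lambda>(b, f). trace_operator b f))"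
proof (intro irreducible_operators.intro irreducible_operators_axioms.intro
    V.finite_dimensional_vector_space_axioms)
  show "Vector_Spaces.linear scV scV T" if "T \<in> range (\<lambda>(b, f). trace_operator b f)" for T
    using that rep_linear[OF trace_invariant] by (auto simp: trace_operator_def)
  show "(UNIV :: 'v set) \<noteq> {0}"
    using irreducible by (simp add: irreducible_representation_def)
  fix W assume W: "V.subspace W"
    and stable: "\<And>T. T \<in> range (\<lambda>(b, f). trace_operator b f) \<Longrightarrow> T ` W \<subseteq> W"
  have trace: "rep (free_trace p) v \<in> W" if "v \<in> W" for p v
  proof (induction p rule: free_induct)
    case zero
    then show ?case
      by (simp add: additive.zero[OF additive_rep_trace] V.subspace_0[OF W])
  next
    case (of b f)
    show ?case
      using stable[of "trace_operator b f"] that by (auto simp: trace_operator_def)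
  next
    case (diff p q)
    then show ?case
      by (simp add: additive.diff[OF additive_rep_trace] V.subspace_diff[OF W])
  qed
  have "rep p v \<in> W" if p: "p \<in> invariant" and v: "v \<in> W" for p v
  proof -
    have "scV (inverse (of_nat (Coset.order G))) (rep (free_trace p) v) \<in> W"
      by (rule V.subspace_scale[OF W trace[OF v]])
    then show ?thesis
      using order_nonzero by (simp add: rep_trace_invariant[OF p])
  qed
  then have "\<forall>C\<in>carrier \<MM>. \<rho> C ` W \<subseteq> W"
    by (auto simp: carrier_equivariant rep_def)
  then show "W = {0} \<or> W = UNIV"
    using irreducible W by (simp add: irreducible_representation_def)
qed

sublocale T: irreducible_trace scA scB G actA actB scV F trace_operator
proof (intro irreducible_trace.intro irreducible_trace_axioms.intro irreducible_operators_trace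
    A.commutative_algebra_action_axioms B.algebra_action_axioms order_nonzero)
  let ?of = "\<lambda>b f. frag_of (b, f) :: 'b \<times> 'a \<Rightarrow>\<^sub>0 int"
  show "trace_operator b (f + f') v = trace_operator b f v + trace_operator b f' v" for b f f' v
  proof -
    have "?of b (f + f') - (?of b f + ?of b f') \<in> null"
      using null_add_right[of b f f'] by (simp add: algebra_simps)
    from rep_trace_cong[OF this] show ?thesis
      by (simp add: trace_operator_def additive.add[OF additive_rep_trace])
  qed
  show "trace_operator b (scA c f) v = scV c (trace_operator b f v)" for b c f v
  proof -
    have "free_trace (free_scale scB c (?of b f)) = free_scale scB c (free_trace (?of b f))"
      by (auto simp: free_trace_def additive.sum[OF additive_free_scale] B.act_scale intro!: sum.cong)
    moreover have "rep (free_trace (?of (scB c b) f)) = rep (free_trace (?of b (scA c f)))"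
      by (rule rep_trace_cong[OF null_balanced])
    ultimately have "rep (free_trace (?of b (scA c f))) = (\<lambda>v. scV c (rep (free_trace (?of b f)) v))"
      by (simp add: rep_scale[OF trace_invariant])
    then show ?thesis
      by (simp add: trace_operator_def)
  qed
  show "trace_operator (actB g b) (actA g f) = trace_operator b f" if "g \<in> carrier G" for g b f
    using free_trace_act[OF that, of "?of b f"] by (simp add: trace_operator_def)
  show "trace_operator b f (trace_operator b' f' v) =
      (\<Sum>h\<in>carrier G. trace_operator (b * actB h b') (f * actA h f') v)" for b f b' f' v
  proof -
    have "trace_operator b f (trace_operator b' f' v) =
        rep (free_mult (free_trace (?of b f)) (free_trace (?of b' f'))) v"
      by (simp add: trace_operator_def rep_mult trace_invariant)
    also have "free_mult (free_trace (?of b f)) (free_trace (?of b' f'))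
        = free_trace (\<Sum>h\<in>carrier G. ?of (b * actB h b') (f * actA h f'))"
      by (simp add: trace_mult_trace additive.sum[OF additive_free_trace])
    finally show ?thesis
      by (simp add: trace_operator_def additive.sum[OF additive_rep_trace])
  qed
  show "trace_operator 1 1 v = scV (of_nat (Coset.order G)) v" for v
    using rep_trace_invariant[OF invariant_one, of v] by (simp add: trace_operator_def rep_one)
qed

text \<open>
  Write \<open>p\<close> as \<open>\<Sum>e. e \<otimes> c e\<close> with \<open>e\<close> in a basis of \<open>\<aa>\<close>. By equivariance \<open>p\<close> vanishes on the whole
  orbit of the point, so all \<open>c e\<close> do, and \<open>|G| \<rho>(p)\<close> is the sum of the operators
  \<open>trace_operator e (c e) = 0\<close>.
\<close>

lemma rep_kernel:
  assumes \<chi>: "\<chi> \<in> alg_hom (type_alg scA) (type_alg (*))"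
    and vanish: "\<And>b f v. (\<And>g. g \<in> carrier G \<Longrightarrow> \<chi> (actA g f) = 0) \<Longrightarrow> trace_operator b f v = 0"
    and p: "p \<in> invariant" and zero: "free_eval scB \<chi> p = 0"
  shows "rep p v = 0"
proof -
  obtain c where c: "p - (\<Sum>e\<in>E. frag_of (e, c e)) \<in> null"
    using basis_expansion[OF B.finite_dimensional_vector_space_axioms] by blast
  let ?s = "\<Sum>e\<in>E. frag_of (e, c e)"
  have coeff: "\<chi> (actA g (c e)) = 0" if g: "g \<in> carrier G" and e: "e \<in> E" for g e
  proof -
    have "free_eval scB \<chi> (ga g (p - ?s)) = 0" "free_eval scB \<chi> (ga g p - p) = 0"
      using c p g by (intro free_eval_null[OF \<chi>] null_act; simp add: invariant_def)+
    then have "free_eval scB \<chi> (ga g ?s) = 0"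
      using zero by (simp add: additive.diff[OF additive_free_act] additive.diff[OF additive_free_eval])
    then have "free_eval scB (\<lambda>f. \<chi> (actA g f)) ?s = 0"
      using g by (simp add: free_eval_act B.act_zero)
    then have "(\<Sum>e\<in>E. scB (\<chi> (actA g (c e))) e) = 0"
      by (simp add: additive.sum[OF additive_free_eval])
    then show ?thesis
      using B.independentD[OF B.independent_Basis B.finite_Basis order_refl, of "\<lambda>e. \<chi> (actA g (c e))"] e
      by blast
  qed
  have "scV (of_nat (Coset.order G)) (rep p v) = rep (free_trace ?s) v"
    using rep_trace_cong[OF c] rep_trace_invariant[OF p, of v] by simp
  also have "\<dots> = (\<Sum>e\<in>E. trace_operator e (c e) v)"
    by (simp add: additive.sum[OF additive_rep_trace] trace_operator_def)
  also have "\<dots> = 0"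
    by (intro sum.neutral ballI vanish coeff)
  finally show ?thesis
    using order_nonzero by simp
qed

text \<open>
  \<open>\<rho>\<close> vanishes on the kernel of \<open>ev\<^sub>x\<close>, so it descends to the image of \<open>ev\<^sub>x\<close>, which is \<open>\<aa>\<^sup>x\<close>. The
  descended map has the same operators as \<open>\<rho>\<close>; therefore it is irreducible as well, and Burnside's
  theorem shows that these are all operators.
\<close>

theorem factors_through_evaluation:
  "\<exists>x \<rho>x. k_rational_point scA x \<and>
      irreducible_representation (isotropy_alg G scB actB actA x) scV \<rho>x \<and>
      (\<forall>\<alpha>\<in>carrier \<MM>. \<rho> \<alpha> = \<rho>x (evaluation scB scA x \<alpha>)) \<and>
      \<rho>x ` carrier (isotropy_alg G scB actB actA x) = carrier (End_alg scV)"
proof -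
  obtain \<chi> where \<chi>: "\<chi> \<in> alg_hom (type_alg scA) (type_alg (*))"
    and vanish: "\<And>b f v. (\<And>g. g \<in> carrier G \<Longrightarrow> \<chi> (actA g f) = 0) \<Longrightarrow> trace_operator b f v = 0"
    using T.character_controls_trace by blast
  define x where "x = {f. \<chi> f = 0}"
  have x: "k_rational_point scA x" and v: "value_at scA x = \<chi>"
    unfolding x_def by (rule character_point[OF A.k_algebra_axioms \<chi>])+
  let ?I = "isotropy_alg G scB actB actA x" and ?ev = "free_eval scB \<chi>"
  note ev_scale = free_eval_scale[OF \<chi>] and ev_add = additive.add[OF additive_free_eval, of \<chi>]
  define \<rho>x where "\<rho>x b = rep (SOME p. p \<in> invariant \<and> ?ev p = b)" for b
  have \<rho>x: "\<rho>x (?ev p) = rep p" if p: "p \<in> invariant" for p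
  proof
    fix w
    define q where "q = (SOME q. q \<in> invariant \<and> ?ev q = ?ev p)"
    have q: "q \<in> invariant \<and> ?ev q = ?ev p"
      unfolding q_def by (rule someI[of _ p]) (use p in simp)
    then have "rep (q + free_scale scB (-1) p) w = 0"
      using p by (intro rep_kernel[OF \<chi> vanish] invariant_add invariant_scale)
        (simp_all add: ev_add ev_scale)
    then have "rep q w = rep p w"
      using q p by (simp add: rep_add rep_scale invariant_scale)
    then show "\<rho>x (?ev p) w = rep p w"
      by (simp add: \<rho>x_def q_def)
  qed
  have isotropy: "carrier ?I = ?ev ` invariant"
    using evaluation_image[OF x order_nonzero]
    by (simp add: carrier_equivariant image_image evaluation_coset[OF x] v)
  have image: "\<rho>x ` carrier ?I = \<rho> ` carrier \<MM>"
    by (simp add: isotropy image_image \<rho>x carrier_equivariant rep_def)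
  have "\<rho>x \<in> ring_hom ?I (End_alg scV)"
  proof (rule ring_hom_memI)
    show "\<rho>x b \<in> carrier (End_alg scV)" if "b \<in> carrier ?I" for b
      using that by (auto simp: isotropy \<rho>x rep_linear)
    show "\<rho>x (b \<otimes>\<^bsub>?I\<^esub> b') = \<rho>x b \<otimes>\<^bsub>End_alg scV\<^esub> \<rho>x b'" if "b \<in> carrier ?I" "b' \<in> carrier ?I" for b b'
      using that by (auto simp: isotropy \<rho>x invariant_mult rep_mult simp flip: free_eval_mult[OF \<chi>])
    show "\<rho>x (b \<oplus>\<^bsub>?I\<^esub> b') = \<rho>x b \<oplus>\<^bsub>End_alg scV\<^esub> \<rho>x b'" if "b \<in> carrier ?I" "b' \<in> carrier ?I" for b b'
      using that by (auto simp: isotropy \<rho>x invariant_add rep_add simp flip: ev_add)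
    show "\<rho>x \<one>\<^bsub>?I\<^esub> = \<one>\<^bsub>End_alg scV\<^esub>"
      using \<rho>x[OF invariant_one] by (simp add: rep_one character_simps[OF \<chi>])
  qed
  moreover have "\<rho>x (c \<odot>\<^bsub>?I\<^esub> b) = c \<odot>\<^bsub>End_alg scV\<^esub> \<rho>x b" if "b \<in> carrier ?I" for c b
    using that by (auto simp: isotropy \<rho>x invariant_scale rep_scale simp flip: ev_scale)
  ultimately have "representation ?I scV \<rho>x"
    by (simp add: representation_def alg_hom_def V.vector_space_axioms)
  then have "irreducible_representation ?I scV \<rho>x"
    by (rule irreducible_representation_image[OF irreducible _ image[symmetric]])
  moreover have "\<forall>\<alpha>\<in>carrier \<MM>. \<rho> \<alpha> = \<rho>x (evaluation scB scA x \<alpha>)"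
    by (auto simp: carrier_equivariant evaluation_coset[OF x] v \<rho>x rep_def)
  moreover have "\<rho>x ` carrier ?I = carrier (End_alg scV)"
  proof -
    interpret S: irreducible_operator_algebra scV F "rep ` invariant"
    proof (intro irreducible_operator_algebra.intro irreducible_operator_algebra_axioms.intro
        irreducible_operators.intro irreducible_operators_axioms.intro
        V.finite_dimensional_vector_space_axioms)
      show "Vector_Spaces.linear scV scV P" if "P \<in> rep ` invariant" for P
        using that rep_linear by auto
      show "(UNIV :: 'v set) \<noteq> {0}"
        using irreducible by (simp add: irreducible_representation_def)
      show "W = {0} \<or> W = UNIV" if "V.subspace W" "\<And>P. P \<in> rep ` invariant \<Longrightarrow> P ` W \<subseteq> W" for W
        using that irreducible
        by (auto simp: irreducible_representation_def carrier_equivariant rep_def)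
      show "(\<lambda>v. P v + R v) \<in> rep ` invariant" if "P \<in> rep ` invariant" "R \<in> rep ` invariant" for P R
        using that by (auto simp flip: rep_add intro: invariant_add)
      show "(\<lambda>v. scV a (P v)) \<in> rep ` invariant" if "P \<in> rep ` invariant" for P a
        using that by (auto simp flip: rep_scale intro: invariant_scale)
      show "P \<circ> R \<in> rep ` invariant" if "P \<in> rep ` invariant" "R \<in> rep ` invariant" for P R
        using that by (auto simp flip: rep_mult intro: invariant_mult)
      show "id \<in> rep ` invariant"
        using invariant_one rep_one by (metis image_eqI)
    qed
    have "\<rho> ` carrier \<MM> = rep ` invariant"
      by (simp add: carrier_equivariant image_image rep_def)
    then show ?thesis
      using S.burnside S.operator_linear image by auto
  qed
  ultimately show ?thesis
    using x by blast
qed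

end

theorem theorem2p1:
  fixes scA :: "'k::alg_closed_field \<Rightarrow> 'a::{comm_ring, comm_monoid_mult} \<Rightarrow> 'a"
    and scB :: "'k \<Rightarrow> 'b::{ring, monoid_mult} \<Rightarrow> 'b"
    and G :: "('g, 'm) monoid_scheme"
    and actA :: "'g \<Rightarrow> 'a \<Rightarrow> 'a"
    and actB :: "'g \<Rightarrow> 'b \<Rightarrow> 'b"
    and scV :: "'k \<Rightarrow> 'v::ab_group_add \<Rightarrow> 'v"
  assumes "k_algebra scA"
    and "k_algebra scB" and "\<exists>Basis. finite_dimensional_vector_space scB Basis"
    and "group G" and "finite (carrier G)" and "\<not> CHAR('k) dvd Coset.order G"
    and "acts_by_automorphisms G scA actA"
    and "acts_by_automorphisms G scB actB"
    and "vector_space scV"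
  shows "(\<forall>\<rho>. (\<exists>Basis. finite_dimensional_vector_space scV Basis) \<and>
             irreducible_representation (equivariant_map_alg G scB actB scA actA) scV \<rho> \<longrightarrow>
           (\<exists>x \<rho>x. k_rational_point scA x \<and>
              irreducible_representation (isotropy_alg G scB actB actA x) scV \<rho>x \<and>
              (\<forall>\<alpha>\<in>carrier (equivariant_map_alg G scB actB scA actA).
                 \<rho> \<alpha> = \<rho>x (evaluation scB scA x \<alpha>)) \<and>
              evaluation scB scA x ` carrier (equivariant_map_alg G scB actB scA actA)
                = carrier (isotropy_alg G scB actB actA x) \<and>
              \<rho>x ` carrier (isotropy_alg G scB actB actA x) = carrier (End_alg scV) \<and>
              (\<exists>S. finite S \<and>
                 Modules.module.span scB S = carrier (isotropy_alg G scB actB actA x)))) \<and>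
         (\<forall>x \<rho>x. k_rational_point scA x \<and>
             irreducible_representation (isotropy_alg G scB actB actA x) scV \<rho>x \<longrightarrow>
           irreducible_representation (equivariant_map_alg G scB actB scA actA) scV
             (\<rho>x \<circ> evaluation scB scA x))"
proof -
  interpret equivariant_maps scA scB G actA actB
    using assms by (intro equivariant_maps.intro commutative_algebra_action.intro
        algebra_action.intro algebra_action_axioms.intro)
  have order: "of_nat (Coset.order G) \<noteq> (0::'k)"
    using assms(6) by (simp add: of_nat_eq_0_iff_char_dvd)
  obtain E where E: "finite_dimensional_vector_space scB E"
    using assms(3) by blast
  show ?thesis
  proof (intro conjI allI impI)
    fix \<rho> assume \<rho>: "(\<exists>Basis. finite_dimensional_vector_space scV Basis) \<and>
      irreducible_representation \<MM> scV \<rho>"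
    then obtain F where F: "finite_dimensional_vector_space scV F" by blast
    interpret irreducible_equivariant_representation scA scB G actA actB E scV F \<rho>
      using \<rho> E F order by (intro irreducible_equivariant_representation.intro
          irreducible_equivariant_representation_axioms.intro equivariant_maps_axioms) auto
    show "\<exists>x \<rho>x. k_rational_point scA x \<and>
        irreducible_representation (isotropy_alg G scB actB actA x) scV \<rho>x \<and>
        (\<forall>\<alpha>\<in>carrier \<MM>. \<rho> \<alpha> = \<rho>x (evaluation scB scA x \<alpha>)) \<and>
        evaluation scB scA x ` carrier \<MM> = carrier (isotropy_alg G scB actB actA x) \<and>
        \<rho>x ` carrier (isotropy_alg G scB actB actA x) = carrier (End_alg scV) \<and>
        (\<exists>S. finite S \<and> B.span S = carrier (isotropy_alg G scB actB actA x))"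
      using factors_through_evaluation evaluation_image[OF _ order] isotropy_finite_span[OF E]
      by meson
  next
    fix x \<rho>x
    assume *: "k_rational_point scA x \<and>
      irreducible_representation (isotropy_alg G scB actB actA x) scV \<rho>x"
    then have "representation \<MM> scV (\<rho>x \<circ> evaluation scB scA x)"
      by (intro evaluation_representation) (auto simp: irreducible_representation_def)
    moreover have "\<rho>x ` carrier (isotropy_alg G scB actB actA x)
        = (\<rho>x \<circ> evaluation scB scA x) ` carrier \<MM>"
      unfolding image_comp[symmetric] evaluation_image[OF conjunct1[OF *] order] ..
    ultimately show "irreducible_representation \<MM> scV (\<rho>x \<circ> evaluation scB scA x)"
      using * irreducible_representation_image by blast
  qed
qed

end
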